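(* Let $(B^{n},g)$ be a Riemannian manifold with two smooth functions $f>0$ and $\varphi$ satisfying $$Ric+\nabla^{2}\varphi=\lambda g+\frac{m}{f}\nabla^{2}f \quad\text{and}\quad 2\lambda\varphi-|\nabla\varphi|^{2}+\Delta\varphi+\frac{m}{f}\nabla\varphi(f)=c$$ on $B$, for some constants $m,c,\lambda\in\mathbb{R}$ with $m\neq 0$. Then there is a constant $\mu\in\mathbb{R}$ such that $$\lambda f^{2}+f\Delta f+(m-1)|\nabla f|^{2}-f\nabla\varphi(f)=\mu$$ on $B$.
   Context: Manifolds are smooth and connected. $Ric$ is the Ricci tensor of $g$; the gradient $\nabla$, Hessian $\nabla^2$, Laplacian $\Delta=\mathrm{tr}(\nabla^2)$ and norms are with respect to $g$; $\nabla\varphi(f)=g(\nabla\varphi,\nabla f)$. *)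

theory Defs
  imports "HOL-Analysis.Analysis"
begin

(* Meant for open S: all iterated directional derivatives of order at most k exist and are
   continuous on S, i.e. f is of class C^k. *)
fun Ck_on :: "nat \<Rightarrow> 'a::real_normed_vector set \<Rightarrow> ('a \<Rightarrow> 'b::real_normed_vector) \<Rightarrow> bool" where
  "Ck_on 0 S f \<longleftrightarrow> continuous_on S f"
| "Ck_on (Suc k) S f \<longleftrightarrow>
     (\<forall>x\<in>S. f differentiable (at x)) \<and> (\<forall>v. Ck_on k S (\<lambda>x. frechet_derivative f (at x) v))"

definition smooth_on :: "'a::real_normed_vector set \<Rightarrow> ('a \<Rightarrow> 'b::real_normed_vector) \<Rightarrow> bool" where
  "smooth_on S f \<longleftrightarrow> (\<forall>k. Ck_on k S f)"

(* A chart is a domain together with a coordinate map, whose values off the domain are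
   irrelevant. *)
type_synonym ('p, 'n) chart = "'p set \<times> ('p \<Rightarrow> (real, 'n) vec)"

abbreviation chart_dom :: "('p, 'n::finite) chart \<Rightarrow> 'p set" where
  "chart_dom \<equiv> fst"

abbreviation coords :: "('p, 'n::finite) chart \<Rightarrow> 'p \<Rightarrow> real^'n" where
  "coords \<equiv> snd"

definition in_chart :: "('p, 'n::finite) chart \<Rightarrow> ('p \<Rightarrow> 'b) \<Rightarrow> real^'n \<Rightarrow> 'b" where
  "in_chart \<kappa> h = h \<circ> inv_into (chart_dom \<kappa>) (coords \<kappa>)"

(* The atlas is not required to be maximal; it determines the smooth structure. *)
locale smooth_manifold =
  fixes X :: "'p topology" and \<A> :: "('p, 'n::finite) chart set"
  assumes Hausdorff: "Hausdorff_space X"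
    and second_countable: "second_countable X"
    and cover: "(\<Union>\<kappa>\<in>\<A>. chart_dom \<kappa>) = topspace X"
    and dom_open: "\<kappa> \<in> \<A> \<Longrightarrow> openin X (chart_dom \<kappa>)"
    and image_open: "\<kappa> \<in> \<A> \<Longrightarrow> open (coords \<kappa> ` chart_dom \<kappa>)"
    and homeomorphic: "\<kappa> \<in> \<A> \<Longrightarrow>
      homeomorphic_map (subtopology X (chart_dom \<kappa>)) (top_of_set (coords \<kappa> ` chart_dom \<kappa>)) (coords \<kappa>)"
    and transition: "\<kappa> \<in> \<A> \<Longrightarrow> \<kappa>' \<in> \<A> \<Longrightarrow>
      smooth_on (coords \<kappa> ` (chart_dom \<kappa> \<inter> chart_dom \<kappa>')) (in_chart \<kappa> (coords \<kappa>'))"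

definition smooth_function :: "('p, 'n::finite) chart set \<Rightarrow> ('p \<Rightarrow> real) \<Rightarrow> bool" where
  "smooth_function \<A> h \<longleftrightarrow> (\<forall>\<kappa>\<in>\<A>. smooth_on (coords \<kappa> ` chart_dom \<kappa>) (in_chart \<kappa> h))"

(* The coordinate vector field of the i-th coordinate of the chart, applied to h. *)
definition coord_deriv :: "('p, 'n::finite) chart \<Rightarrow> 'n \<Rightarrow> ('p \<Rightarrow> real) \<Rightarrow> 'p \<Rightarrow> real" where
  "coord_deriv \<kappa> i h p = frechet_derivative (in_chart \<kappa> h) (at (coords \<kappa> p)) (axis i 1)"

(* Tensor fields are given by their components in every chart: g \<kappa> p is the matrix of the
   metric at p in the coordinate basis of the chart \<kappa>. *)
type_synonym ('p, 'n) metric = "('p, 'n) chart \<Rightarrow> 'p \<Rightarrow> ((real, 'n) vec, 'n) vec"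

locale riemannian_manifold = smooth_manifold X \<A>
  for X :: "'p topology" and \<A> :: "('p, 'n::finite) chart set" +
  fixes g :: "('p, 'n) metric"
  assumes metric_smooth: "\<kappa> \<in> \<A> \<Longrightarrow>
      smooth_on (coords \<kappa> ` chart_dom \<kappa>) (in_chart \<kappa> (\<lambda>p. g \<kappa> p $ i $ j))"
    and metric_sym: "\<kappa> \<in> \<A> \<Longrightarrow> p \<in> chart_dom \<kappa> \<Longrightarrow> transpose (g \<kappa> p) = g \<kappa> p"
    and metric_pos: "\<kappa> \<in> \<A> \<Longrightarrow> p \<in> chart_dom \<kappa> \<Longrightarrow> v \<noteq> 0 \<Longrightarrow> v \<bullet> (g \<kappa> p *v v) > 0"
    and metric_transform: "\<kappa> \<in> \<A> \<Longrightarrow> \<kappa>' \<in> \<A> \<Longrightarrow> p \<in> chart_dom \<kappa> \<inter> chart_dom \<kappa>' \<Longrightarrow>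
      g \<kappa> p $ i $ j = (\<Sum>a\<in>UNIV. \<Sum>b\<in>UNIV.
        coord_deriv \<kappa> i (\<lambda>q. coords \<kappa>' q $ a) p * coord_deriv \<kappa> j (\<lambda>q. coords \<kappa>' q $ b) p
          * g \<kappa>' p $ a $ b)"

(* Levi-Civita connection: nabla_{d_i} d_j = sum over k of (christoffel g \<kappa> k i j) d_k. *)
definition christoffel ::
  "('p, 'n::finite) metric \<Rightarrow> ('p, 'n) chart \<Rightarrow> 'n \<Rightarrow> 'n \<Rightarrow> 'n \<Rightarrow> 'p \<Rightarrow> real" where
  "christoffel g \<kappa> k i j p = (\<Sum>l\<in>UNIV. matrix_inv (g \<kappa> p) $ k $ l *
     (coord_deriv \<kappa> i (\<lambda>q. g \<kappa> q $ j $ l) p + coord_deriv \<kappa> j (\<lambda>q. g \<kappa> q $ i $ l) p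
       - coord_deriv \<kappa> l (\<lambda>q. g \<kappa> q $ i $ j) p)) / 2"

(* Sign convention: R(d_i, d_j) d_k = sum over l of (curvature g \<kappa> l i j k) d_l, where
   R(X,Y)Z = nabla_X nabla_Y Z - nabla_Y nabla_X Z - nabla_[X,Y] Z. *)
definition curvature ::
  "('p, 'n::finite) metric \<Rightarrow> ('p, 'n) chart \<Rightarrow> 'n \<Rightarrow> 'n \<Rightarrow> 'n \<Rightarrow> 'n \<Rightarrow> 'p \<Rightarrow> real" where
  "curvature g \<kappa> l i j k p =
     coord_deriv \<kappa> i (christoffel g \<kappa> l j k) p - coord_deriv \<kappa> j (christoffel g \<kappa> l i k) p
     + (\<Sum>s\<in>UNIV. christoffel g \<kappa> l i s p * christoffel g \<kappa> s j k p
         - christoffel g \<kappa> l j s p * christoffel g \<kappa> s i k p)"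

(* Ric(Y,Z) is the trace of X \<mapsto> R(X,Y)Z; it is positive on round spheres. *)
definition Ric :: "('p, 'n::finite) metric \<Rightarrow> ('p, 'n) chart \<Rightarrow> 'p \<Rightarrow> real^'n^'n" where
  "Ric g \<kappa> p = (\<chi> j k. \<Sum>i\<in>UNIV. curvature g \<kappa> i i j k p)"

definition differential :: "('p, 'n::finite) chart \<Rightarrow> ('p \<Rightarrow> real) \<Rightarrow> 'p \<Rightarrow> real^'n" where
  "differential \<kappa> h p = (\<chi> i. coord_deriv \<kappa> i h p)"

definition gradient ::
  "('p, 'n::finite) metric \<Rightarrow> ('p, 'n) chart \<Rightarrow> ('p \<Rightarrow> real) \<Rightarrow> 'p \<Rightarrow> real^'n" where
  "gradient g \<kappa> h p = matrix_inv (g \<kappa> p) *v differential \<kappa> h p"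

definition Hessian ::
  "('p, 'n::finite) metric \<Rightarrow> ('p, 'n) chart \<Rightarrow> ('p \<Rightarrow> real) \<Rightarrow> 'p \<Rightarrow> real^'n^'n" where
  "Hessian g \<kappa> h p = (\<chi> i j. coord_deriv \<kappa> i (coord_deriv \<kappa> j h) p
     - (\<Sum>k\<in>UNIV. christoffel g \<kappa> k i j p * coord_deriv \<kappa> k h p))"

definition laplacian ::
  "('p, 'n::finite) metric \<Rightarrow> ('p, 'n) chart \<Rightarrow> ('p \<Rightarrow> real) \<Rightarrow> 'p \<Rightarrow> real" where
  "laplacian g \<kappa> h p = trace (matrix_inv (g \<kappa> p) ** Hessian g \<kappa> h p)"

definition metric_inner ::
  "('p, 'n::finite) metric \<Rightarrow> ('p, 'n) chart \<Rightarrow> 'p \<Rightarrow> real^'n \<Rightarrow> real^'n \<Rightarrow> real" where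
  "metric_inner g \<kappa> p v w = v \<bullet> (g \<kappa> p *v w)"

definition metric_norm ::
  "('p, 'n::finite) metric \<Rightarrow> ('p, 'n) chart \<Rightarrow> 'p \<Rightarrow> real^'n \<Rightarrow> real" where
  "metric_norm g \<kappa> p v = sqrt (metric_inner g \<kappa> p v v)"

end

theory Submission
  imports Defs
begin

text \<open>
Taking the divergence of the first equation, the contracted Bianchi identity 2 div Ric = dR and
Bochner's formula div Hess u = d(Laplacian u) + Ric(grad u) turn the left-hand side into
dR/2 + d(Laplacian of the potential) + Ric(grad of the potential). The trace of the first equation
eliminates dR, its contractions with the two gradients eliminate the Ricci terms, and the
differentiated second equation eliminates the remaining third derivatives of the potential. What is
left is a nonvanishing multiple of the differential of the claimed constant.

The pointwise calculation only uses commuting derivations, so it is carried out over a commutative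
ring; germs of smooth functions at a point of a chart form such a ring, which frees the calculation
from all smoothness side conditions. A locally constant function is constant on a connected space
once it is known to be independent of the chart; for the Laplacian this follows from the
polarization identity, which expresses the Hessian through inner products of gradients.
\<close>

section \<open>Levi-Civita calculus over a ring with commuting derivations\<close>

text \<open>Both equations are assumed in every chart, so the calculation is done inside one chart
  at a time, and curvature and Christoffel symbols are never compared between charts. Only the final
  scalar is compared, where the awkward ingredient is the Hessian. Testing it on gradients of the
  coordinate functions of the second chart avoids the transformation law of the Christoffel symbols.

  An abstract ring with derivations has no points, hence no normal coordinates: the curvature
  identities must come from an algebraic cancellation of all Christoffel products.

  Germs are convenient for a further reason. \<open>in_chart\<close> is unspecified off the image of
  the chart domain, and the metric components off the domain satisfy no assumption, so identities
  between components hold only near the point; passing to germs turns them into equations.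

  The nonvanishing multiple is m/f^2. It is cancelled by explicit inverses of m and f, because germs
  of smooth functions have zero divisors.\<close>

locale commuting_derivations =
  fixes D :: "'i::finite \<Rightarrow> 'r::comm_ring_1 \<Rightarrow> 'r"
  assumes D_add: "D i (a + b) = D i a + D i b"
    and D_mult: "D i (a * b) = D i a * b + a * D i b"
    and D_commute: "D i (D j a) = D j (D i a)"
begin

lemma D_zero: "D i 0 = 0"
  using D_add[of i 0 0] by simp

lemma D_one: "D i 1 = 0"
  using D_mult[of i 1 1] by simp

lemma D_minus: "D i (- a) = - D i a"
  using D_add[of i a "- a"] by (simp add: D_zero eq_neg_iff_add_eq_0 add.commute)

lemma D_diff: "D i (a - b) = D i a - D i b"
  using D_add[of i a "- b"] by (simp add: D_minus)

lemma D_sum: "D i (\<Sum>x\<in>A. a x) = (\<Sum>x\<in>A. D i (a x))"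
  by (induction A rule: infinite_finite_induct) (simp_all add: D_zero D_add)

lemma D_if_const: "D i (if P then 1 else 0) = 0"
  by (simp add: D_zero D_one)

lemmas D_simps = D_zero D_one D_minus D_diff D_add D_mult D_sum

end

text \<open>Associativity of the matrix product, entrywise. It regroups nearly all double
  contractions below; index functions serve as matrices.\<close>

lemma sum_mult_assoc:
  fixes A B E :: "'i::finite \<Rightarrow> 'i \<Rightarrow> 'r::comm_semiring_0"
  shows "(\<Sum>s\<in>UNIV. (\<Sum>t\<in>UNIV. A l t * B t s) * E s k) = (\<Sum>s\<in>UNIV. A l s * (\<Sum>t\<in>UNIV. B s t * E t k))"
  unfolding sum_distrib_left sum_distrib_right
  by (subst sum.swap) (simp add: mult.assoc)

lemma sum_delta_mult:
  fixes a :: "'i::finite \<Rightarrow> 'r::comm_ring_1"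
  shows "(\<Sum>s\<in>UNIV. (if i = s then 1 else 0) * a s) = a i"
    "(\<Sum>s\<in>UNIV. (if s = i then 1 else 0) * a s) = a i"
    "(\<Sum>s\<in>UNIV. a s * (if i = s then 1 else 0)) = a i"
    "(\<Sum>s\<in>UNIV. a s * (if s = i then 1 else 0)) = a i"
  by (simp_all add: if_distrib[of "\<lambda>x. x * _"] if_distrib[of "\<lambda>x. _ * x"] cong: if_cong)

lemma unit_cancel:
  fixes m m' k f a :: "'r::comm_ring_1"
  assumes "f * k = 1" "m * m' = 1" "m * k * (k * a) = 0"
  shows "a = 0"
proof -
  have "a = (m * m') * (f * k) * (f * k) * a"
    unfolding assms by simp
  also have "\<dots> = (m' * f * f) * (m * k * (k * a))"
    by (simp only: mult_ac)
  finally show ?thesis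
    unfolding assms by simp
qed

text \<open>For a fixed index i: dR, dLf and dLp are the derivatives of the scalar curvature and of the Laplacians Lf
of f and Lp of the potential; ricf and ricp are the contractions of Ric with the two gradients, A and fp
those of the Hessian of f, pf and pp those of the Hessian of the potential (gradient of f first); k = 1/f.\<close>
lemma soliton_elimination:
  fixes dR dLp dLf ricp ricf A df dp Lf ip pp pf fp lam m k m' f :: "'r::comm_ring_1"
  assumes unit: "f * k = 1" "m * m' = 1"
    and eqs: "dR + 2 * (dLp + ricp) = 2 * (m * k * (dLf + ricf)) - 2 * (m * k\<^sup>2 * A)"
      "dR + dLp = m * k * dLf - m * k\<^sup>2 * df * Lf"
      "ricp + pp = lam * dp + m * k * fp"
      "ricf + pf = lam * df + m * k * A"
      "2 * lam * dp - 2 * pp + dLp - m * k\<^sup>2 * df * ip + m * k * (pf + fp) = 0"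
  shows "2 * lam * f * df + df * Lf + f * dLf + 2 * (m - 1) * A - df * ip - f * (pf + fp) = 0"
    (is "?E = 0")
proof (rule unit_cancel[OF unit])
  have "k * ?E = 2 * lam * df * (f * k) + k * (df * Lf) + dLf * (f * k) + 2 * (m - 1) * (k * A)
      - k * (df * ip) - (pf + fp) * (f * k)"
    by (simp add: algebra_simps)
  then have kE: "k * ?E = 2 * lam * df + k * (df * Lf) + dLf + 2 * (m - 1) * (k * A) - k * (df * ip) - (pf + fp)"
    unfolding unit by simp
  \<comment> \<open>The multipliers of the five equations are -1, 1, 2, -2mk and 1. The first two
    remove \<open>dR\<close>, the third then removes \<open>ricp\<close>, the fourth
    \<open>ricf\<close>, and the last one what is left of \<open>dLp\<close> and
    \<open>pp\<close>.\<close>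
  have "m * k * (2 * lam * df + k * (df * Lf) + dLf + 2 * (m - 1) * (k * A) - k * (df * ip) - (pf + fp))
    = (2 * (m * k * (dLf + ricf)) - 2 * (m * k\<^sup>2 * A) - (dR + 2 * (dLp + ricp)))
      + ((dR + dLp) - (m * k * dLf - m * k\<^sup>2 * df * Lf))
      + 2 * ((ricp + pp) - (lam * dp + m * k * fp))
      - 2 * m * k * ((ricf + pf) - (lam * df + m * k * A))
      + (2 * lam * dp - 2 * pp + dLp - m * k\<^sup>2 * df * ip + m * k * (pf + fp))"
    by (simp add: algebra_simps power2_eq_square)
  also have "\<dots> = 0"
    unfolding eqs by simp
  finally have "m * k * (2 * lam * df + k * (df * Lf) + dLf + 2 * (m - 1) * (k * A) - k * (df * ip) - (pf + fp)) = 0" .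
  then show "m * k * (k * ?E) = 0"
    unfolding kE .
qed

text \<open>g is the metric, h its inverse and C k i j the Christoffel symbol with upper index k.\<close>
locale levi_civita = commuting_derivations D
  for D :: "'i::finite \<Rightarrow> 'r::comm_ring_1 \<Rightarrow> 'r" +
  fixes g h :: "'i \<Rightarrow> 'i \<Rightarrow> 'r" and C :: "'i \<Rightarrow> 'i \<Rightarrow> 'i \<Rightarrow> 'r"
  assumes g_sym: "g i j = g j i"
    and h_sym: "h i j = h j i"
    and h_g: "(\<Sum>k\<in>UNIV. h i k * g k j) = (if i = j then 1 else 0)"
    and torsion_free: "C k i j = C k j i"
    and D_g: "D i (g j k) = (\<Sum>s\<in>UNIV. C s i j * g s k) + (\<Sum>s\<in>UNIV. C s i k * g j s)"
begin

lemma g_h: "(\<Sum>k\<in>UNIV. g i k * h k j) = (if i = j then 1 else 0)"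
  using h_g[of j i] by (simp add: g_sym[of _ i] h_sym[of j] mult.commute eq_commute)

text \<open>The entries of h g are constant, so (D h) g = - h (D g), and multiplication by h from
  the right isolates D h. After substituting \<open>D_g\<close>, each of the two sums contains a
  product of g and h that collapses.\<close>

lemma D_h: "D i (h j k) = - (\<Sum>s\<in>UNIV. C j i s * h s k) - (\<Sum>s\<in>UNIV. C k i s * h j s)"
proof -
  have key: "(\<Sum>b\<in>UNIV. D i (h j b) * g b c) = - (\<Sum>b\<in>UNIV. h j b * D i (g b c))" for c
  proof -
    have "(\<Sum>b\<in>UNIV. D i (h j b) * g b c) + (\<Sum>b\<in>UNIV. h j b * D i (g b c)) = D i (\<Sum>b\<in>UNIV. h j b * g b c)"
      by (simp add: D_simps sum.distrib)
    also have "\<dots> = 0"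
      by (simp add: h_g D_if_const)
    finally show ?thesis by (simp add: eq_neg_iff_add_eq_0)
  qed
  have "D i (h j k) = (\<Sum>b\<in>UNIV. D i (h j b) * (\<Sum>c\<in>UNIV. g b c * h c k))"
    by (simp add: g_h sum_delta_mult)
  also have "\<dots> = (\<Sum>c\<in>UNIV. (\<Sum>b\<in>UNIV. D i (h j b) * g b c) * h c k)"
    by (rule sum_mult_assoc[symmetric, where A = "\<lambda>j b. D i (h j b)"])
  also have "\<dots> = - (\<Sum>c\<in>UNIV. (\<Sum>b\<in>UNIV. h j b * (\<Sum>s\<in>UNIV. C s i b * g s c)) * h c k)
                  - (\<Sum>c\<in>UNIV. (\<Sum>b\<in>UNIV. h j b * (\<Sum>s\<in>UNIV. C s i c * g b s)) * h c k)"
    unfolding key D_g by (simp add: sum.distrib algebra_simps sum_negf sum_subtractf)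
  also have "(\<Sum>c\<in>UNIV. (\<Sum>b\<in>UNIV. h j b * (\<Sum>s\<in>UNIV. C s i b * g s c)) * h c k)
     = (\<Sum>b\<in>UNIV. h j b * (\<Sum>c\<in>UNIV. (\<Sum>s\<in>UNIV. C s i b * g s c) * h c k))"
    using sum_mult_assoc[of h j "\<lambda>b c. \<Sum>s\<in>UNIV. C s i b * g s c" h k] .
  also have "\<dots> = (\<Sum>b\<in>UNIV. h j b * C k i b)"
    using sum_mult_assoc[of "\<lambda>b s. C s i b" _ g h k] by (simp add: g_h sum_delta_mult)
  also have "(\<Sum>c\<in>UNIV. (\<Sum>b\<in>UNIV. h j b * (\<Sum>s\<in>UNIV. C s i c * g b s)) * h c k)
     = (\<Sum>c\<in>UNIV. (\<Sum>s\<in>UNIV. (\<Sum>b\<in>UNIV. h j b * g b s) * C s i c) * h c k)"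
    using sum_mult_assoc[of h j g "\<lambda>s c. C s i c"] by (simp add: mult.commute)
  also have "\<dots> = (\<Sum>c\<in>UNIV. C j i c * h c k)"
    by (simp add: h_g sum_delta_mult)
  finally show ?thesis
    by (simp add: mult.commute)
qed

section \<open>Curvature, covariant derivatives and contractions\<close>

definition Rm :: "'i \<Rightarrow> 'i \<Rightarrow> 'i \<Rightarrow> 'i \<Rightarrow> 'r" where
  "Rm l i j k = D i (C l j k) - D j (C l i k)
     + (\<Sum>s\<in>UNIV. C l i s * C s j k - C l j s * C s i k)"

definition Rc :: "'i \<Rightarrow> 'i \<Rightarrow> 'r" where
  "Rc j k = (\<Sum>i\<in>UNIV. Rm i i j k)"

definition cov2 :: "('i \<Rightarrow> 'i \<Rightarrow> 'r) \<Rightarrow> 'i \<Rightarrow> 'i \<Rightarrow> 'i \<Rightarrow> 'r" where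
  "cov2 T i j k = D i (T j k) - (\<Sum>s\<in>UNIV. C s i j * T s k) - (\<Sum>s\<in>UNIV. C s i k * T j s)"

text \<open>The covariant derivative of the curvature tensor in direction \<open>m\<close>; the
  upper index \<open>l\<close> contributes with a plus sign, the lower ones with a minus
  sign.\<close>

definition covRm :: "'i \<Rightarrow> 'i \<Rightarrow> 'i \<Rightarrow> 'i \<Rightarrow> 'i \<Rightarrow> 'r" where
  "covRm m l i j k = D m (Rm l i j k) + (\<Sum>s\<in>UNIV. C l m s * Rm s i j k)
     - (\<Sum>s\<in>UNIV. C s m i * Rm l s j k) - (\<Sum>s\<in>UNIV. C s m j * Rm l i s k)
     - (\<Sum>s\<in>UNIV. C s m k * Rm l i j s)"

definition tr :: "('i \<Rightarrow> 'i \<Rightarrow> 'r) \<Rightarrow> 'r" where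
  "tr T = (\<Sum>j\<in>UNIV. \<Sum>k\<in>UNIV. h j k * T j k)"

text \<open>The derivative index is contracted with the second index of \<open>T\<close>, so that
  the free index \<open>i\<close> is the first one.\<close>

definition dvg :: "('i \<Rightarrow> 'i \<Rightarrow> 'r) \<Rightarrow> 'i \<Rightarrow> 'r" where
  "dvg T i = (\<Sum>j\<in>UNIV. \<Sum>k\<in>UNIV. h j k * cov2 T j i k)"

text \<open>The 1-form T(., grad u).\<close>

definition contr :: "('i \<Rightarrow> 'i \<Rightarrow> 'r) \<Rightarrow> 'r \<Rightarrow> 'i \<Rightarrow> 'r" where
  "contr T u i = (\<Sum>j\<in>UNIV. \<Sum>k\<in>UNIV. h j k * (T i j * D k u))"

definition hess :: "'r \<Rightarrow> 'i \<Rightarrow> 'i \<Rightarrow> 'r" where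
  "hess u i j = D i (D j u) - (\<Sum>k\<in>UNIV. C k i j * D k u)"

definition grad_inner :: "'r \<Rightarrow> 'r \<Rightarrow> 'r" where
  "grad_inner u v = (\<Sum>j\<in>UNIV. \<Sum>k\<in>UNIV. h j k * (D j u * D k v))"

text \<open>The value T(grad w, grad v): \<open>w\<close> fills the first slot.\<close>

definition grad_form :: "('i \<Rightarrow> 'i \<Rightarrow> 'r) \<Rightarrow> 'r \<Rightarrow> 'r \<Rightarrow> 'r" where
  "grad_form T v w = (\<Sum>i\<in>UNIV. \<Sum>l\<in>UNIV. h i l * (contr T v i * D l w))"

lemma Rm_antisym: "Rm l i j k = - Rm l j i k"
  by (simp add: Rm_def sum_subtractf)

lemma hess_sym: "hess u i j = hess u j i"
  unfolding hess_def by (simp add: D_commute[of i j] torsion_free[of _ i j])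

text \<open>By D_h the derivative of h cancels both Christoffel terms of the covariant derivative of T.\<close>
lemma D_tr: "D i (tr T) = tr (cov2 T i)"
proof -
  have 1: "(\<Sum>j\<in>UNIV. \<Sum>k\<in>UNIV. (\<Sum>s\<in>UNIV. C j i s * h s k) * T j k)
     = (\<Sum>j\<in>UNIV. \<Sum>k\<in>UNIV. h j k * (\<Sum>s\<in>UNIV. C s i j * T s k))"
    (is "?l = ?r")
  proof -
    have "?l = (\<Sum>k\<in>UNIV. \<Sum>s\<in>UNIV. h s k * (\<Sum>j\<in>UNIV. C j i s * T j k))"
      by (subst sum.swap, simp only: sum_distrib_left sum_distrib_right)
        (rule sum.cong[OF refl], subst sum.swap, simp add: algebra_simps)
    also have "\<dots> = ?r"
      by (rule sum.swap)
    finally show ?thesis .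
  qed
  have 2: "(\<Sum>j\<in>UNIV. \<Sum>k\<in>UNIV. (\<Sum>s\<in>UNIV. C k i s * h j s) * T j k)
     = (\<Sum>j\<in>UNIV. \<Sum>k\<in>UNIV. h j k * (\<Sum>s\<in>UNIV. C s i k * T j s))"
    unfolding sum_distrib_left sum_distrib_right
    by (rule sum.cong[OF refl], subst sum.swap) (simp add: algebra_simps)
  show ?thesis
    using 1 2 unfolding tr_def cov2_def
    by (simp add: D_simps D_h sum.distrib sum_subtractf algebra_simps)
qed


text \<open>With \<open>C m\<close> read as a matrix in the outer indices \<open>l\<close> and
  \<open>k\<close>, \<open>Rm\<close> is the commutator of the operators D + C in the directions
  \<open>i\<close> and \<open>j\<close>, and the claim is the Jacobi identity for three such
  operators. The Christoffel terms at the inner indices cancel in pairs, since C is torsion free and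
  \<open>Rm\<close> is antisymmetric.\<close>

lemma Bianchi: "covRm m l i j k + covRm i l j m k + covRm j l m i k = 0"
proof -
  \<comment> \<open>\<open>P\<close> is the product of two Christoffel matrices, \<open>Q\<close>
    and \<open>Q'\<close> are the two halves of its derivative, and \<open>T\<close> is the product
    of three.\<close>
  define P where "P a b l k = (\<Sum>s\<in>UNIV. C l a s * C s b k)" for a b l k
  define Q where "Q m a b l k = (\<Sum>s\<in>UNIV. D m (C l a s) * C s b k)" for m a b l k
  define Q' where "Q' m a b l k = (\<Sum>s\<in>UNIV. C l a s * D m (C s b k))" for m a b l k
  define T where "T m a b l k = (\<Sum>s\<in>UNIV. C l m s * P a b s k)" for m a b l k
  have T': "(\<Sum>s\<in>UNIV. P a b l s * C s m k) = T a b m l k" for m a b l k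
    unfolding T_def P_def
    using sum_mult_assoc[of "\<lambda>l s. C l a s" l "\<lambda>s t. C s b t" "\<lambda>s k. C s m k" k] by simp
  have DP: "D m (P a b l k) = Q m a b l k + Q' m a b l k" for m a b l k
    unfolding P_def Q_def Q'_def by (simp add: D_simps sum.distrib)
  have Rm_P: "Rm l i j k = D i (C l j k) - D j (C l i k) + P i j l k - P j i l k" for l i j k
    unfolding Rm_def P_def by (simp add: sum_subtractf)
  have 1: "(\<Sum>s\<in>UNIV. C l m s * Rm s i j k) = Q' i m j l k - Q' j m i l k + T m i j l k - T m j i l k" for m i j l
    unfolding Rm_P Q'_def T_def by (simp add: sum.distrib sum_subtractf algebra_simps)
  have 2: "(\<Sum>s\<in>UNIV. C s m k * Rm l i j s) = Q i j m l k - Q j i m l k + T i j m l k - T j i m l k" for m i j l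
    unfolding Rm_P Q_def T'[symmetric] by (simp add: sum.distrib sum_subtractf algebra_simps)
  have 3: "(\<Sum>s\<in>UNIV. C s i m * Rm l s j k) = - (\<Sum>s\<in>UNIV. C s m i * Rm l j s k)" for m i j
    by (simp add: torsion_free[of _ i m] Rm_antisym[of l _ j] sum_negf)
  show ?thesis
    unfolding covRm_def 1 2 3 unfolding Rm_P
    by (simp add: D_simps DP D_commute[of j m] D_commute[of j i] D_commute[of i m])
qed

text \<open>Apply the commutator of D i and D j to h.\<close>
lemma Rm_skew: "(\<Sum>s\<in>UNIV. Rm m i j s * h s l) = - (\<Sum>s\<in>UNIV. Rm l i j s * h s m)"
proof -
  \<comment> \<open>\<open>A i\<close> is \<open>C i\<close> with its last index raised, so D h is
    minus the sum of \<open>A i\<close> and its transpose. In the commutator the terms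
    \<open>E\<close>, of the form C h C^T, cancel by \<open>E_swap\<close>; the terms
    \<open>A'\<close> and \<open>B\<close> assemble to the curvature.\<close>
  define A where "A i m l = (\<Sum>s\<in>UNIV. C m i s * h s l)" for i m l
  define A' where "A' i j m l = (\<Sum>s\<in>UNIV. D i (C m j s) * h s l)" for i j m l
  define B where "B i j m l = (\<Sum>s\<in>UNIV. C m i s * A j s l)" for i j m l
  define E where "E i j m l = (\<Sum>s\<in>UNIV. C m i s * A j l s)" for i j m l
  have Dh: "D i (h m l) = - A i m l - A i l m" for i m l
    unfolding D_h A_def by (simp add: h_sym[of m])
  have DA: "D i (A j m l) = A' i j m l - B j i m l - E j i m l" for i j m l
    unfolding A'_def B_def E_def
    by (subst A_def) (simp add: D_simps Dh sum.distrib sum_subtractf algebra_simps sum_negf)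
  have E_swap: "E i j m l = E j i l m" for i j m l
    unfolding E_def A_def sum_distrib_left
    by (subst sum.swap) (simp add: h_sym mult.left_commute)
  have Rh: "(\<Sum>s\<in>UNIV. Rm m i j s * h s l) = A' i j m l - A' j i m l + B i j m l - B j i m l" for m l
  proof -
    have "B i j m l = (\<Sum>s\<in>UNIV. (\<Sum>t\<in>UNIV. C m i t * C t j s) * h s l)" for i j
      unfolding B_def A_def using sum_mult_assoc[of "\<lambda>m s. C m i s" m "\<lambda>s t. C s j t" h l] by simp
    then show ?thesis
      unfolding Rm_def A'_def by (simp add: sum.distrib sum_subtractf algebra_simps)
  qed
  have "D i (D j (h m l)) - D j (D i (h m l)) = 0"
    by (simp add: D_commute[of i j])
  then show ?thesis
    unfolding Rh Dh by (simp add: D_simps DA E_swap[of i j] algebra_simps)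
qed

text \<open>\<open>Rm_skew\<close> exchanges the free upper index with the traced one; the trace
  over the last two indices thus becomes the trace that defines Ricci, up to raising an
  index.\<close>

lemma tr_Rm: "tr (Rm m i) = (\<Sum>k\<in>UNIV. h m k * Rc i k)"
proof -
  have "tr (Rm m i) = (\<Sum>j\<in>UNIV. \<Sum>s\<in>UNIV. Rm m i j s * h s j)"
    unfolding tr_def by (simp add: h_sym mult.commute)
  also have "\<dots> = (\<Sum>j\<in>UNIV. \<Sum>s\<in>UNIV. Rm j j i s * h s m)"
    unfolding Rm_skew[of m] by (simp add: Rm_antisym[of _ i] sum_negf)
  also have "\<dots> = (\<Sum>k\<in>UNIV. h m k * Rc i k)"
    unfolding Rc_def sum_distrib_left by (subst sum.swap) (simp add: h_sym mult.commute)
  finally show ?thesis .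
qed


text \<open>Contraction of an upper with a lower index commutes with covariant differentiation: the
  two Christoffel sums at the contracted indices have opposite signs and cancel.\<close>

lemma covRm_trace: "(\<Sum>m\<in>UNIV. covRm i m m j k) = cov2 Rc i j k"
proof -
  have "(\<Sum>m\<in>UNIV. \<Sum>s\<in>UNIV. C m i s * Rm s m j k) = (\<Sum>m\<in>UNIV. \<Sum>s\<in>UNIV. C s i m * Rm m s j k)"
    by (rule sum.swap)
  moreover have "(\<Sum>m\<in>UNIV. \<Sum>s\<in>UNIV. C s i j * Rm m m s k) = (\<Sum>s\<in>UNIV. C s i j * Rc s k)"
    unfolding Rc_def sum_distrib_left by (rule sum.swap)
  moreover have "(\<Sum>m\<in>UNIV. \<Sum>s\<in>UNIV. C s i k * Rm m m j s) = (\<Sum>s\<in>UNIV. C s i k * Rc j s)"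
    unfolding Rc_def sum_distrib_left by (rule sum.swap)
  ultimately show ?thesis
    unfolding covRm_def cov2_def by (simp add: Rc_def D_sum sum.distrib sum_subtractf)
qed

lemma covRm_antisym: "covRm m l i j k = - covRm m l j i k"
  unfolding covRm_def
  by (simp add: Rm_antisym[of _ i] Rm_antisym[of l _ j] D_minus sum_negf)

text \<open>The left-hand side is the covariant derivative of \<open>T\<close> with its second index
  raised. Raising commutes with the derivative because h is parallel, which is the content of
  \<open>D_h\<close>.\<close>

lemma cov2_raise: "D m (\<Sum>k\<in>UNIV. h l k * T i k) + (\<Sum>s\<in>UNIV. C l m s * (\<Sum>k\<in>UNIV. h s k * T i k))
    - (\<Sum>s\<in>UNIV. C s m i * (\<Sum>k\<in>UNIV. h l k * T s k)) = (\<Sum>k\<in>UNIV. h l k * cov2 T m i k)"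
proof -
  have 1: "(\<Sum>k\<in>UNIV. (\<Sum>s\<in>UNIV. C l m s * h s k) * T i k)
     = (\<Sum>s\<in>UNIV. C l m s * (\<Sum>k\<in>UNIV. h s k * T i k))"
    using sum_mult_assoc[of "\<lambda>l s. C l m s" l h "\<lambda>k i. T i k" i] .
  have 2: "(\<Sum>k\<in>UNIV. (\<Sum>s\<in>UNIV. C k m s * h l s) * T i k)
     = (\<Sum>k\<in>UNIV. h l k * (\<Sum>s\<in>UNIV. C s m k * T i s))"
    unfolding sum_distrib_left sum_distrib_right by (subst sum.swap) (simp add: mult_ac)
  have 3: "(\<Sum>s\<in>UNIV. C s m i * (\<Sum>k\<in>UNIV. h l k * T s k))
     = (\<Sum>k\<in>UNIV. h l k * (\<Sum>s\<in>UNIV. C s m i * T s k))"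
    unfolding sum_distrib_left sum_distrib_right by (subst sum.swap) (simp add: mult_ac)
  show ?thesis
    unfolding 1[symmetric] 3 cov2_def
    using 2 by (simp add: D_simps D_h sum.distrib sum_subtractf algebra_simps)
qed

lemma tr_add: "tr (\<lambda>j k. S j k + T j k) = tr S + tr T"
  unfolding tr_def by (simp add: sum.distrib algebra_simps)

lemma tr_diff: "tr (\<lambda>j k. S j k - T j k) = tr S - tr T"
  unfolding tr_def by (simp add: sum_subtractf algebra_simps)

lemma tr_scale: "tr (\<lambda>j k. a * T j k) = a * tr T"
  unfolding tr_def by (simp add: sum_distrib_left algebra_simps)

lemma tr_sum: "tr (\<lambda>j k. \<Sum>s\<in>A. T s j k) = (\<Sum>s\<in>A. tr (T s))"
  unfolding tr_def sum_distrib_left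
  by (subst sum.swap[of _ UNIV A]) (simp add: sum.swap[of _ A])

text \<open>Tracing the last two indices commutes with the derivative by \<open>D_tr\<close>. The
  two remaining Christoffel sums belong to the mixed Ricci tensor produced by \<open>tr_Rm\<close>,
  to which \<open>cov2_raise\<close> applies.\<close>

lemma tr_covRm: "tr (covRm m l i) = (\<Sum>k\<in>UNIV. h l k * cov2 Rc m i k)"
proof -
  have "covRm m l i = (\<lambda>j k. cov2 (Rm l i) m j k + (\<Sum>s\<in>UNIV. C l m s * Rm s i j k) - (\<Sum>s\<in>UNIV. C s m i * Rm l s j k))"
    by (intro ext) (simp add: covRm_def cov2_def)
  then have "tr (covRm m l i) = D m (tr (Rm l i)) + (\<Sum>s\<in>UNIV. C l m s * tr (Rm s i)) - (\<Sum>s\<in>UNIV. C s m i * tr (Rm l s))"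
    by (simp add: tr_add tr_diff tr_sum tr_scale D_tr)
  then show ?thesis
    unfolding tr_Rm cov2_raise .
qed

text \<open>Contract the Bianchi identity over \<open>m\<close> and the upper index, then over
  \<open>j\<close> and \<open>k\<close>. Two of the three cyclic terms are derivatives of Ricci by
  \<open>covRm_trace\<close>; the third is once more the divergence by \<open>tr_covRm\<close>,
  hence the 2. The factor stays on the left, as 2 need not be invertible in the ring.\<close>

lemma contracted_Bianchi: "2 * dvg Rc i = D i (tr Rc)"
proof -
  have "(\<Sum>m\<in>UNIV. covRm m m i j k) = cov2 Rc i j k - cov2 Rc j i k" for j k
  proof -
    have "(\<Sum>m\<in>UNIV. covRm m m i j k + covRm i m j m k + covRm j m m i k) = 0"
      by (simp add: Bianchi)
    then show ?thesis
      by (simp add: sum.distrib sum_subtractf covRm_antisym[of i _ j] covRm_trace algebra_simps)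
  qed
  then have "tr (\<lambda>j k. \<Sum>m\<in>UNIV. covRm m m i j k) = D i (tr Rc) - dvg Rc i"
    by (simp add: tr_diff D_tr) (simp add: tr_def dvg_def)
  moreover have "tr (\<lambda>j k. \<Sum>m\<in>UNIV. covRm m m i j k) = dvg Rc i"
    unfolding tr_sum tr_covRm dvg_def ..
  ultimately show ?thesis
    by (simp add: algebra_simps)
qed

text \<open>Both sides are third covariant derivatives of \<open>u\<close>. Exchanging the two outer
  derivatives, which act on the 1-form du, costs a curvature term with the sign for
  covectors.\<close>

lemma Ricci_identity: "cov2 (hess u) j i k = cov2 (hess u) i j k + (\<Sum>l\<in>UNIV. Rm l i j k * D l u)"
proof -
  have 1: "(\<Sum>s\<in>UNIV. C s j k * (\<Sum>t\<in>UNIV. D t u * C t i s)) = (\<Sum>l\<in>UNIV. D l u * (\<Sum>s\<in>UNIV. C l i s * C s j k))" for i j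
    using sum_mult_assoc[of "\<lambda>k s. C s j k" k "\<lambda>s t. C t i s" "\<lambda>t _. D t u"] by (simp add: mult_ac)
  show ?thesis
    unfolding cov2_def hess_def Rm_def
    by (simp add: D_simps D_commute[of j i] torsion_free[of _ j i]
       sum.distrib sum_subtractf ring_distribs 1 mult_ac)
qed

text \<open>The trace of the Ricci identity over \<open>j\<close> and \<open>k\<close>;
  \<open>tr_Rm\<close> identifies the curvature term.\<close>

lemma dvg_hess: "dvg (hess u) i = D i (tr (hess u)) + contr Rc u i"
proof -
  have "dvg (hess u) i = tr (\<lambda>j k. cov2 (hess u) i j k + (\<Sum>l\<in>UNIV. D l u * Rm l i j k))"
    unfolding dvg_def tr_def Ricci_identity[of u _ i] by (simp add: mult.commute)
  also have "\<dots> = D i (tr (hess u)) + (\<Sum>l\<in>UNIV. D l u * tr (Rm l i))"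
    by (simp add: tr_add tr_sum tr_scale D_tr)
  also have "(\<Sum>l\<in>UNIV. D l u * tr (Rm l i)) = contr Rc u i"
    unfolding tr_Rm contr_def sum_distrib_left by (subst sum.swap) (simp add: h_sym mult_ac)
  finally show ?thesis .
qed

lemma D_grad_inner: "D i (grad_inner u v) = contr (hess u) v i + contr (hess v) u i"
proof -
  have "cov2 (\<lambda>j k. D j u * D k v) i = (\<lambda>j k. hess u i j * D k v + D j u * hess v i k)"
    unfolding cov2_def hess_def
    by (intro ext) (simp add: D_simps sum_distrib_left sum_distrib_right algebra_simps)
  then have "D i (grad_inner u v) = tr (\<lambda>j k. hess u i j * D k v) + tr (\<lambda>j k. D j u * hess v i k)"
    using D_tr[of i "\<lambda>j k. D j u * D k v"] by (simp add: tr_add) (simp add: tr_def grad_inner_def)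
  also have "tr (\<lambda>j k. D j u * hess v i k) = contr (hess v) u i"
    unfolding tr_def contr_def by (subst sum.swap) (simp add: h_sym mult_ac)
  finally show ?thesis
    by (simp add: tr_def contr_def)
qed

section \<open>Linearity and product rules for divergence and contraction\<close>

lemma cov2_g: "cov2 g i j k = 0"
  by (simp add: cov2_def D_g)

lemma dvg_add: "dvg (\<lambda>j k. S j k + T j k) i = dvg S i + dvg T i"
  unfolding dvg_def cov2_def by (simp add: D_add sum.distrib algebra_simps sum_subtractf)

lemma dvg_scale: "dvg (\<lambda>j k. a * T j k) i = a * dvg T i + contr T a i"
proof -
  have "cov2 (\<lambda>j k. a * T j k) j i k = a * cov2 T j i k + T i k * D j a" for i j k
    unfolding cov2_def by (simp add: D_mult sum_distrib_left algebra_simps)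
  moreover have "(\<Sum>j\<in>UNIV. \<Sum>k\<in>UNIV. h j k * (T i k * D j a)) = contr T a i"
    unfolding contr_def by (subst sum.swap) (simp add: h_sym)
  ultimately show ?thesis
    unfolding dvg_def by (simp add: sum.distrib sum_distrib_left ring_distribs mult_ac)
qed

lemma contr_g: "contr g u i = D i u"
proof -
  have "contr g u i = (\<Sum>k\<in>UNIV. (\<Sum>j\<in>UNIV. g i j * h j k) * D k u)"
    unfolding contr_def sum_distrib_right by (subst sum.swap) (simp add: mult_ac)
  then show ?thesis
    by (simp add: g_h sum_delta_mult)
qed

lemma contr_add: "contr (\<lambda>j k. S j k + T j k) u i = contr S u i + contr T u i"
  unfolding contr_def by (simp add: sum.distrib algebra_simps)

lemma contr_scale: "contr (\<lambda>j k. a * T j k) u i = a * contr T u i"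
  unfolding contr_def by (simp add: sum_distrib_left algebra_simps)

lemma contr_fun_scale: "(\<And>k. D k u = a * D k v) \<Longrightarrow> contr T u i = a * contr T v i"
  unfolding contr_def by (simp add: sum_distrib_left algebra_simps)

text \<open>The theorem in the ring: \<open>k\<close> and \<open>m'\<close> play the roles of 1/f
  and 1/m, and a constant is an element killed by every derivation. Applied to the germs at one
  point.\<close>

lemma soliton_first_integral:
  assumes unit: "f * k = 1" "m * m' = 1"
    and const: "\<And>i. D i lam = 0" "\<And>i. D i m = 0" "\<And>i. D i c = 0"
    and Ricci_eq: "\<And>i j. Rc i j + hess \<phi> i j = lam * g i j + (m * k) * hess f i j"
    and scalar_eq: "2 * lam * \<phi> - grad_inner \<phi> \<phi> + tr (hess \<phi>) + m * k * grad_inner \<phi> f = c"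
  shows "D i (lam * f\<^sup>2 + f * tr (hess f) + (m - 1) * grad_inner f f - f * grad_inner \<phi> f) = 0"
proof -
  \<comment> \<open>The quotient rule, from differentiating \<open>f * k = 1\<close> and multiplying
    by \<open>k\<close>.\<close>
  have Dk: "D j k = - k\<^sup>2 * D j f" for j
  proof -
    have "k * D j (f * k) = 0"
      unfolding unit by (simp add: D_one)
    then have "k * k * D j f + (f * k) * D j k = 0"
      by (simp add: D_mult algebra_simps)
    then show ?thesis
      by (simp add: unit power2_eq_square eq_neg_iff_add_eq_0 add.commute)
  qed
  have Dmk: "D j (m * k) = - m * k\<^sup>2 * D j f" for j
    by (simp add: D_mult const Dk)
  have eq: "(\<lambda>i j. Rc i j + hess \<phi> i j) = (\<lambda>i j. lam * g i j + (m * k) * hess f i j)"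
    using Ricci_eq by (intro ext)
  have dvg_g: "dvg g i = 0"
    by (simp add: dvg_def cov2_g)
  have D_tr_g: "D i (tr g) = 0"
    unfolding D_tr by (simp add: tr_def cov2_g)
  have contr_lam: "contr g lam i = 0"
    by (simp add: contr_def const)
  have dvg_eq: "dvg Rc i + dvg (hess \<phi>) i = (m * k) * dvg (hess f) i - m * k\<^sup>2 * contr (hess f) f i"
    using arg_cong[OF eq, of "\<lambda>T. dvg T i"] contr_fun_scale[of "m * k", OF Dmk]
    by (simp add: dvg_add dvg_scale dvg_g contr_lam)
  \<comment> \<open>Twice the divergence of the first equation, the form in which the contracted
    Bianchi identity can be inserted.\<close>
  have e1: "D i (tr Rc) + 2 * (D i (tr (hess \<phi>)) + contr Rc \<phi> i)
      = 2 * (m * k * (D i (tr (hess f)) + contr Rc f i)) - 2 * (m * k\<^sup>2 * contr (hess f) f i)"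
  proof -
    have "D i (tr Rc) + 2 * (D i (tr (hess \<phi>)) + contr Rc \<phi> i) = 2 * (dvg Rc i + dvg (hess \<phi>) i)"
      unfolding contracted_Bianchi[symmetric] dvg_hess by (simp only: distrib_left)
    also have "\<dots> = 2 * ((m * k) * dvg (hess f) i - m * k\<^sup>2 * contr (hess f) f i)"
      by (simp only: dvg_eq)
    finally show ?thesis
      unfolding dvg_hess by (simp only: right_diff_distrib)
  qed
  have e2: "D i (tr Rc) + D i (tr (hess \<phi>)) = m * k * D i (tr (hess f)) - m * k\<^sup>2 * D i f * tr (hess f)"
    using arg_cong[OF eq, of "\<lambda>T. D i (tr T)"]
    by (simp add: tr_add tr_scale D_add D_mult[of i lam] D_mult[of i "m * k"] Dmk D_tr_g const)
  \<comment> \<open>Contraction of the first equation with a gradient; needed for both the potential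
    and \<open>f\<close>.\<close>
  have e3: "contr Rc u i + contr (hess \<phi>) u i = lam * D i u + m * k * contr (hess f) u i" for u
    using arg_cong[OF eq, of "\<lambda>T. contr T u i"] by (simp add: contr_add contr_scale contr_g)
  have D2: "D i 2 = 0"
    using D_add[of i 1 1] by (simp add: D_one)
  have e5: "2 * lam * D i \<phi> - 2 * contr (hess \<phi>) \<phi> i + D i (tr (hess \<phi>)) - m * k\<^sup>2 * D i f * grad_inner \<phi> f
      + m * k * (contr (hess \<phi>) f i + contr (hess f) \<phi> i) = 0"
  proof -
    have "D i (2 * lam * \<phi> - grad_inner \<phi> \<phi> + tr (hess \<phi>) + m * k * grad_inner \<phi> f) = 0"
      unfolding scalar_eq by (rule const)
    then show ?thesis
      by (simp only: D_diff D_add D_mult[of i _ \<phi>] D_mult[of i "m * k"] D_mult[of i 2] D2 const Dmk D_grad_inner)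
        (simp add: algebra_simps)
  qed
  let ?E = "2 * lam * f * D i f + D i f * tr (hess f) + f * D i (tr (hess f)) + 2 * (m - 1) * contr (hess f) f i
     - D i f * grad_inner \<phi> f - f * (contr (hess \<phi>) f i + contr (hess f) \<phi> i)"
  have E: "?E = 0"
    by (rule soliton_elimination[OF unit e1 e2 e3[of \<phi>] e3[of f] e5])
  have "D i (lam * f\<^sup>2 + f * tr (hess f) + (m - 1) * grad_inner f f - f * grad_inner \<phi> f) = ?E"
    by (simp only: power2_eq_square D_diff D_add D_mult const D_one D_grad_inner) (simp add: algebra_simps)
  then show ?thesis
    unfolding E .
qed

text \<open>The right-hand side involves only grad_inner, which makes the Hessian independent of coordinates.\<close>
lemma hess_polarization:
  "2 * grad_form (hess u) v w = grad_inner (grad_inner u w) v + grad_inner (grad_inner u v) w - grad_inner (grad_inner v w) u"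
proof -
  have grad_form_sym: "grad_form (hess u) v w = grad_form (hess u) w v" for u v w
  proof -
    have eq: "grad_form (hess u) v w = (\<Sum>i\<in>UNIV. \<Sum>l\<in>UNIV. \<Sum>j\<in>UNIV. \<Sum>k\<in>UNIV. h i l * (h j k * (hess u i j * (D k v * D l w))))" for u v w
      unfolding grad_form_def contr_def by (simp add: sum_distrib_left sum_distrib_right mult_ac)
    have swap: "(\<Sum>i\<in>UNIV. \<Sum>l\<in>UNIV. \<Sum>j\<in>UNIV. \<Sum>k\<in>UNIV. X i l j k) = (\<Sum>j\<in>UNIV. \<Sum>k\<in>UNIV. \<Sum>i\<in>UNIV. \<Sum>l\<in>UNIV. X i l j k)"
      for X :: "'i \<Rightarrow> 'i \<Rightarrow> 'i \<Rightarrow> 'i \<Rightarrow> 'r"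
      using sum.swap[of "\<lambda>p q. X (fst p) (snd p) (fst q) (snd q)" "UNIV \<times> UNIV" "UNIV \<times> UNIV"]
      by (simp add: sum.cartesian_product' flip: UNIV_Times_UNIV)
    show ?thesis
      unfolding eq by (subst swap) (simp add: hess_sym[of u] mult_ac)
  qed
  \<comment> \<open>Product rule. In the signed sum of the three double products the Hessians of
    \<open>v\<close> and \<open>w\<close> cancel by symmetry, and that of \<open>u\<close> occurs
    twice.\<close>
  have "grad_inner (grad_inner u v) w = grad_form (hess u) v w + grad_form (hess v) u w" for u v w
    unfolding grad_inner_def[of "grad_inner u v"] grad_form_def D_grad_inner by (simp add: sum.distrib algebra_simps)
  then show ?thesis
    using grad_form_sym[of u v w] grad_form_sym[of v u w] grad_form_sym[of w u v] by (simp add: algebra_simps)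
qed

end

text \<open>Links the explicit Christoffel formula to the axioms of the calculus. With the upper
  index lowered, the formula is \<open>half\<close> times three derivatives of g; adding the version
  with \<open>j\<close> and \<open>k\<close> exchanged leaves only D i (g j k).\<close>

lemma (in commuting_derivations) levi_civita_Koszul:
  fixes g h :: "'i \<Rightarrow> 'i \<Rightarrow> 'r"
  assumes g_sym: "\<And>i j. g i j = g j i" and h_sym: "\<And>i j. h i j = h j i"
    and h_g: "\<And>i j. (\<Sum>k\<in>UNIV. h i k * g k j) = (if i = j then 1 else 0)"
    and half: "half + half = 1"
    and C: "\<And>k i j. C k i j = half * (\<Sum>l\<in>UNIV. h k l * (D i (g j l) + D j (g i l) - D l (g i j)))"
  shows "levi_civita D g h C"
proof unfold_locales
  show torsion_free: "C k i j = C k j i" for k i j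
    unfolding C by (simp add: g_sym[of i j] add.commute)
  have lower: "(\<Sum>s\<in>UNIV. C s i j * g s k) = half * (D i (g j k) + D j (g i k) - D k (g i j))" for i j k
  proof -
    have "(\<Sum>s\<in>UNIV. C s i j * g s k)
      = half * (\<Sum>s\<in>UNIV. (\<Sum>l\<in>UNIV. (D i (g j l) + D j (g i l) - D l (g i j)) * h l s) * g s k)"
      unfolding C by (simp add: sum_distrib_left h_sym[of _ "_ :: 'i"] mult_ac)
    \<comment> \<open>The bracket acts as a row vector; its row index is a dummy, instantiated by
      \<open>undefined\<close>.\<close>
    also have "\<dots> = half * (\<Sum>l\<in>UNIV. (D i (g j l) + D j (g i l) - D l (g i j)) * (\<Sum>s\<in>UNIV. h l s * g s k))"
      using sum_mult_assoc[of "\<lambda>_ l. D i (g j l) + D j (g i l) - D l (g i j)" undefined h g k] by simp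
    finally show ?thesis
      unfolding h_g sum_delta_mult .
  qed
  show "D i (g j k) = (\<Sum>s\<in>UNIV. C s i j * g s k) + (\<Sum>s\<in>UNIV. C s i k * g j s)" for i j k
  proof -
    have "(\<Sum>s\<in>UNIV. C s i j * g s k) + (\<Sum>s\<in>UNIV. C s i k * g j s) = (half + half) * D i (g j k)"
      unfolding g_sym[of j] lower by (simp add: g_sym[of k j] algebra_simps)
    then show ?thesis
      by (simp add: half)
  qed
qed (use g_sym h_sym h_g in auto)

section \<open>Germs of smooth functions\<close>

lemma frechet_derivative_eqI: "(f has_derivative f') (at x) \<Longrightarrow> frechet_derivative f (at x) = f'"
  using frechet_derivative_at by metis

lemma differentiable_cong_open:
  assumes "open S" "x \<in> S" "\<And>y. y \<in> S \<Longrightarrow> f y = g y" "f differentiable (at x)"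
  shows "g differentiable (at x)"
  using assms has_derivative_transform_within_open unfolding differentiable_def by blast

lemma Ck_on_cong:
  assumes "open S" "\<And>x. x \<in> S \<Longrightarrow> f x = g x" "Ck_on k S f"
  shows "Ck_on k S g"
  using assms(2,3)
proof (induction k arbitrary: f g)
  case 0
  then show ?case
    using continuous_on_cong by force
next
  case (Suc k)
  have diff: "f differentiable (at x)" if "x \<in> S" for x
    using Suc.prems that by simp
  have "Ck_on k S (\<lambda>x. frechet_derivative g (at x) v)" for v
  proof (rule Suc.IH)
    show "Ck_on k S (\<lambda>x. frechet_derivative f (at x) v)"
      using Suc.prems by simp
    show "frechet_derivative f (at x) v = frechet_derivative g (at x) v" if "x \<in> S" for x
      using frechet_derivative_transform_within_open[OF diff[OF that] assms(1) that] Suc.prems(1) by metis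
  qed
  then show ?case
    using differentiable_cong_open[OF assms(1) _ Suc.prems(1) diff] by simp
qed

lemma Ck_on_subset: "Ck_on k S f \<Longrightarrow> T \<subseteq> S \<Longrightarrow> Ck_on k T f"
  by (induction k arbitrary: f) (auto intro: continuous_on_subset)

lemma Ck_on_Suc: "Ck_on (Suc k) S f \<Longrightarrow> Ck_on k S f"
proof (induction k arbitrary: f)
  case 0
  then show ?case
    by (simp add: continuous_at_imp_continuous_on differentiable_imp_continuous_within)
qed (metis Ck_on.simps(2))

lemma Ck_on_const: "Ck_on k S (\<lambda>x. c)"
  by (induction k arbitrary: c) simp_all

lemma Ck_on_add:
  assumes "open S" "Ck_on k S f" "Ck_on k S g"
  shows "Ck_on k S (\<lambda>x. f x + g x)"
  using assms(2,3)
proof (induction k arbitrary: f g)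
  case (Suc k)
  show ?case
    unfolding Ck_on.simps
  proof (intro conjI ballI allI)
    show "(\<lambda>x. f x + g x) differentiable at x" if "x \<in> S" for x
      using Suc.prems that by simp
    show "Ck_on k S (\<lambda>x. frechet_derivative (\<lambda>x. f x + g x) (at x) v)" for v
    proof (rule Ck_on_cong[OF \<open>open S\<close>])
      show "Ck_on k S (\<lambda>x. frechet_derivative f (at x) v + frechet_derivative g (at x) v)"
        using Suc by simp
      show "frechet_derivative f (at x) v + frechet_derivative g (at x) v = frechet_derivative (\<lambda>x. f x + g x) (at x) v"
        if "x \<in> S" for x
        using Suc.prems that
        by (subst frechet_derivative_eqI[OF has_derivative_add]) (auto simp: frechet_derivative_works[symmetric])
    qed
  qed
qed (simp add: continuous_on_add)

lemma Ck_on_mult: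
  fixes f g :: "'a::real_normed_vector \<Rightarrow> 'b::real_normed_algebra"
  assumes "open S" "Ck_on k S f" "Ck_on k S g"
  shows "Ck_on k S (\<lambda>x. f x * g x)"
  using assms(2,3)
proof (induction k arbitrary: f g)
  case (Suc k)
  show ?case
    unfolding Ck_on.simps
  proof (intro conjI ballI allI)
    show "(\<lambda>x. f x * g x) differentiable at x" if "x \<in> S" for x
      using Suc.prems that by simp
    show "Ck_on k S (\<lambda>x. frechet_derivative (\<lambda>x. f x * g x) (at x) v)" for v
    proof (rule Ck_on_cong[OF \<open>open S\<close>])
      \<comment> \<open>The undifferentiated factors are needed at order \<open>k\<close> only,
        which \<open>Ck_on_Suc\<close> supplies.\<close>
      show "Ck_on k S (\<lambda>x. f x * frechet_derivative g (at x) v + frechet_derivative f (at x) v * g x)"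
        using Suc.prems Suc.prems[THEN Ck_on_Suc] by (intro Ck_on_add Suc.IH \<open>open S\<close>) auto
      show "f x * frechet_derivative g (at x) v + frechet_derivative f (at x) v * g x = frechet_derivative (\<lambda>x. f x * g x) (at x) v"
        if "x \<in> S" for x
        using Suc.prems that
        by (subst frechet_derivative_eqI[OF has_derivative_mult]) (auto simp: frechet_derivative_works[symmetric])
    qed
  qed
qed (simp add: continuous_on_mult)

lemma Ck_on_bounded_linear:
  assumes "open S" "bounded_linear L" "Ck_on k S f"
  shows "Ck_on k S (\<lambda>x. L (f x))"
  using assms(3)
proof (induction k arbitrary: f)
  case 0
  then show ?case
    using bounded_linear.continuous_on[OF assms(2)] by simp
next
  case (Suc k)
  have der: "((\<lambda>x. L (f x)) has_derivative (\<lambda>v. L (frechet_derivative f (at x) v))) (at x)" if "x \<in> S" for x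
    using Suc.prems that by (intro bounded_linear.has_derivative[OF assms(2)]) (simp add: frechet_derivative_works[symmetric])
  show ?case
    unfolding Ck_on.simps
  proof (intro conjI ballI allI)
    show "(\<lambda>x. L (f x)) differentiable at x" if "x \<in> S" for x
      using der[OF that] by (rule differentiableI)
    show "Ck_on k S (\<lambda>x. frechet_derivative (\<lambda>x. L (f x)) (at x) v)" for v
    proof (rule Ck_on_cong[OF \<open>open S\<close>])
      show "Ck_on k S (\<lambda>x. L (frechet_derivative f (at x) v))"
        using Suc by simp
    qed (simp add: frechet_derivative_eqI[OF der])
  qed
qed

text \<open>The derivative of 1/f contains 1/f again, but only its regularity of the lower order is
  needed. The induction therefore runs with \<open>f\<close> fixed.\<close>

lemma Ck_on_inverse:
  fixes f :: "'a::real_normed_vector \<Rightarrow> real"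
  assumes "open S" "\<And>x. x \<in> S \<Longrightarrow> f x \<noteq> 0" "Ck_on k S f"
  shows "Ck_on k S (\<lambda>x. inverse (f x))"
  using assms(3)
proof (induction k)
  case 0
  then show ?case
    using assms(2) by (simp add: continuous_on_inverse)
next
  case (Suc k)
  have der: "((\<lambda>x. inverse (f x)) has_derivative (\<lambda>v. - (inverse (f x) * frechet_derivative f (at x) v * inverse (f x)))) (at x)" if "x \<in> S" for x
    using Suc.prems that assms(2) by (intro Deriv.has_derivative_inverse) (auto simp: frechet_derivative_works[symmetric])
  show ?case
    unfolding Ck_on.simps
  proof (intro conjI ballI allI)
    show "(\<lambda>x. inverse (f x)) differentiable at x" if "x \<in> S" for x
      using der[OF that] by (rule differentiableI)
    show "Ck_on k S (\<lambda>x. frechet_derivative (\<lambda>x. inverse (f x)) (at x) v)" for v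
    proof (rule Ck_on_cong[OF \<open>open S\<close>])
      show "Ck_on k S (\<lambda>x. (- 1) * (inverse (f x) * frechet_derivative f (at x) v * inverse (f x)))"
        using Suc Ck_on_Suc[OF Suc.prems] by (intro Ck_on_mult Ck_on_const \<open>open S\<close>) auto
    qed (simp add: frechet_derivative_eqI[OF der])
  qed
qed

lemma Ck_on_translate:
  assumes "open S" "Ck_on k S f"
  shows "Ck_on k {y. a + y \<in> S} (\<lambda>y. f (a + y))"
  using assms(2)
proof (induction k arbitrary: f)
  case 0
  then show ?case
    by (auto intro!: continuous_on_compose2[of S f] continuous_intros)
next
  case (Suc k)
  have der: "((\<lambda>y. f (a + y)) has_derivative (\<lambda>v. frechet_derivative f (at (a + y)) v)) (at y)" if "a + y \<in> S" for y
  proof -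
    have "(f has_derivative frechet_derivative f (at (a + y))) (at (a + y))"
      using Suc.prems that by (simp add: frechet_derivative_works[symmetric])
    moreover have "((\<lambda>y. a + y) has_derivative (\<lambda>v. v)) (at y)"
      by (auto intro!: derivative_eq_intros)
    ultimately show ?thesis
      using has_derivative_compose[of "\<lambda>y. a + y" "\<lambda>v. v" y UNIV f] by simp
  qed
  have eq: "frechet_derivative f (at (a + y)) = frechet_derivative (\<lambda>y. f (a + y)) (at y)" if "a + y \<in> S" for y
    using frechet_derivative_eqI[OF der[OF that]] by simp
  have open_translated: "open {y. a + y \<in> S}"
    using open_vimage[OF \<open>open S\<close>, of "\<lambda>y. a + y"] by (simp add: vimage_def continuous_intros)
  have "Ck_on k {y. a + y \<in> S} (\<lambda>y. frechet_derivative f (at (a + y)) v)" for v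
    using Suc.IH[of "\<lambda>x. frechet_derivative f (at x) v"] Suc.prems by simp
  then have "Ck_on k {y. a + y \<in> S} (\<lambda>y. frechet_derivative (\<lambda>y. f (a + y)) (at y) v)" for v
    by (rule Ck_on_cong[rotated 2]) (use open_translated eq in auto)
  then show ?case
    using der differentiableI by fastforce
qed

lemma smooth_on_cong: "open S \<Longrightarrow> (\<And>x. x \<in> S \<Longrightarrow> f x = g x) \<Longrightarrow> smooth_on S f \<Longrightarrow> smooth_on S g"
  unfolding smooth_on_def using Ck_on_cong by blast

lemma smooth_on_subset: "smooth_on S f \<Longrightarrow> T \<subseteq> S \<Longrightarrow> smooth_on T f"
  unfolding smooth_on_def using Ck_on_subset by blast

lemma smooth_on_const: "smooth_on S (\<lambda>x. c)"
  unfolding smooth_on_def using Ck_on_const by blast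

lemma smooth_on_add: "open S \<Longrightarrow> smooth_on S f \<Longrightarrow> smooth_on S g \<Longrightarrow> smooth_on S (\<lambda>x. f x + g x)"
  unfolding smooth_on_def using Ck_on_add by blast

lemma smooth_on_mult:
  fixes f g :: "'a::real_normed_vector \<Rightarrow> 'b::real_normed_algebra"
  shows "open S \<Longrightarrow> smooth_on S f \<Longrightarrow> smooth_on S g \<Longrightarrow> smooth_on S (\<lambda>x. f x * g x)"
  unfolding smooth_on_def using Ck_on_mult by blast

lemma smooth_on_bounded_linear: "open S \<Longrightarrow> bounded_linear L \<Longrightarrow> smooth_on S f \<Longrightarrow> smooth_on S (\<lambda>x. L (f x))"
  unfolding smooth_on_def using Ck_on_bounded_linear by blast

lemma smooth_on_uminus: "open S \<Longrightarrow> smooth_on S f \<Longrightarrow> smooth_on S (\<lambda>x. - f x)"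
  by (rule smooth_on_bounded_linear) (auto intro: bounded_linear_minus bounded_linear_ident)

lemma smooth_on_inverse:
  fixes f :: "'a::real_normed_vector \<Rightarrow> real"
  shows "open S \<Longrightarrow> (\<And>x. x \<in> S \<Longrightarrow> f x \<noteq> 0) \<Longrightarrow> smooth_on S f \<Longrightarrow> smooth_on S (\<lambda>x. inverse (f x))"
  unfolding smooth_on_def using Ck_on_inverse by blast

lemma smooth_on_translate: "open S \<Longrightarrow> smooth_on S f \<Longrightarrow> smooth_on {y. a + y \<in> S} (\<lambda>y. f (a + y))"
  unfolding smooth_on_def using Ck_on_translate by blast

lemma smooth_on_frechet_derivative: "smooth_on S f \<Longrightarrow> smooth_on S (\<lambda>x. frechet_derivative f (at x) v)"
  unfolding smooth_on_def by (metis Ck_on.simps(2))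

lemma smooth_on_differentiable: "smooth_on S f \<Longrightarrow> x \<in> S \<Longrightarrow> f differentiable (at x)"
  unfolding smooth_on_def by (metis Ck_on.simps(2))

lemma smooth_on_continuous_on: "smooth_on S f \<Longrightarrow> continuous_on S f"
  unfolding smooth_on_def by (metis Ck_on.simps(1))

section \<open>Symmetry of second derivatives\<close>

text \<open>Both mixed derivatives are limits of the same double difference quotient.\<close>
lemma mean_value_mixed:
  fixes f :: "'a::real_normed_vector \<Rightarrow> real"
  assumes S: "smooth_on S f" and r: "0 < r" "ball x r \<subseteq> S" and h: "0 < h" "h * norm v + h * norm w < r"
  shows "\<exists>z. norm (z - x) \<le> h * norm v + h * norm w
    \<and> f (x + h *\<^sub>R v + h *\<^sub>R w) - f (x + h *\<^sub>R v) - f (x + h *\<^sub>R w) + f x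
      = h * (h * frechet_derivative (\<lambda>y. frechet_derivative f (at y) v) (at z) w)"
proof -
  have near: "norm (s *\<^sub>R v + t *\<^sub>R w) \<le> h * norm v + h * norm w" if "0 \<le> s" "s \<le> h" "0 \<le> t" "t \<le> h" for s t
    using that by (intro order.trans[OF norm_triangle_ineq] add_mono) (auto intro: mult_right_mono)
  have in_S: "x + s *\<^sub>R v + t *\<^sub>R w \<in> S" if "0 \<le> s" "s \<le> h" "0 \<le> t" "t \<le> h" for s t
  proof -
    have "dist (x + (s *\<^sub>R v + t *\<^sub>R w)) x < r"
      using near[OF that] h(2) by (simp add: dist_norm)
    then have "x + s *\<^sub>R v + t *\<^sub>R w \<in> ball x r"
      by (simp add: dist_commute add.assoc)
    then show ?thesis using r by blast
  qed
  let ?D = "\<lambda>y. frechet_derivative f (at y) v"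
  have line: "((\<lambda>t. F (p + t *\<^sub>R u)) has_real_derivative frechet_derivative F (at (p + t *\<^sub>R u)) u) (at t)"
    if "F differentiable at (p + t *\<^sub>R u)" for F :: "'a \<Rightarrow> real" and p u t
  proof -
    have "((\<lambda>t. p + t *\<^sub>R u) has_derivative (\<lambda>t. t *\<^sub>R u)) (at t)"
      by (auto intro!: derivative_eq_intros)
    moreover have F: "(F has_derivative frechet_derivative F (at (p + t *\<^sub>R u))) (at (p + t *\<^sub>R u))"
      using that by (simp add: frechet_derivative_works)
    ultimately have "((\<lambda>t. F (p + t *\<^sub>R u)) has_derivative (\<lambda>s. frechet_derivative F (at (p + t *\<^sub>R u)) (s *\<^sub>R u))) (at t)"
      using has_derivative_compose[of "\<lambda>t. p + t *\<^sub>R u" "\<lambda>t. t *\<^sub>R u" t UNIV F] by simp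
    moreover have "frechet_derivative F (at (p + t *\<^sub>R u)) (s *\<^sub>R u) = frechet_derivative F (at (p + t *\<^sub>R u)) u * s" for s
      using linear_frechet_derivative[OF that] by (simp add: linear_cmul)
    ultimately show ?thesis
      by (simp add: has_field_derivative_def)
  qed
  \<comment> \<open>Mean value theorem in direction \<open>v\<close>, applied to the increment of
    \<open>f\<close> in direction \<open>w\<close>; a second application in direction
    \<open>w\<close> follows.\<close>
  have "\<exists>\<xi>>0. \<xi> < h \<and> (f (x + h *\<^sub>R w + h *\<^sub>R v) - f (x + h *\<^sub>R v)) - (f (x + h *\<^sub>R w + 0 *\<^sub>R v) - f (x + 0 *\<^sub>R v))
     = (h - 0) * (?D (x + h *\<^sub>R w + \<xi> *\<^sub>R v) - ?D (x + \<xi> *\<^sub>R v))"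
  proof (rule MVT2[OF h(1)])
    fix s assume s: "0 \<le> s" "s \<le> h"
    have "f differentiable at (x + h *\<^sub>R w + s *\<^sub>R v)" "f differentiable at (x + s *\<^sub>R v)"
      using smooth_on_differentiable[OF S in_S[OF s, of h]] smooth_on_differentiable[OF S in_S[OF s, of 0]] h(1)
      by (simp_all add: ac_simps)
    then show "((\<lambda>s. f (x + h *\<^sub>R w + s *\<^sub>R v) - f (x + s *\<^sub>R v)) has_real_derivative
        ?D (x + h *\<^sub>R w + s *\<^sub>R v) - ?D (x + s *\<^sub>R v)) (at s)"
      by (intro DERIV_diff line)
  qed
  then obtain \<xi> where \<xi>: "0 < \<xi>" "\<xi> < h" and eq1:
    "f (x + h *\<^sub>R w + h *\<^sub>R v) - f (x + h *\<^sub>R v) - f (x + h *\<^sub>R w) + f x = h * (?D (x + h *\<^sub>R w + \<xi> *\<^sub>R v) - ?D (x + \<xi> *\<^sub>R v))"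
    by (auto simp: algebra_simps)
  have "\<exists>\<eta>>0. \<eta> < h \<and> ?D (x + \<xi> *\<^sub>R v + h *\<^sub>R w) - ?D (x + \<xi> *\<^sub>R v + 0 *\<^sub>R w)
     = (h - 0) * frechet_derivative ?D (at (x + \<xi> *\<^sub>R v + \<eta> *\<^sub>R w)) w"
  proof (rule MVT2[OF h(1)])
    fix t assume t: "0 \<le> t" "t \<le> h"
    show "((\<lambda>t. ?D (x + \<xi> *\<^sub>R v + t *\<^sub>R w)) has_real_derivative frechet_derivative ?D (at (x + \<xi> *\<^sub>R v + t *\<^sub>R w)) w) (at t)"
      using smooth_on_differentiable[OF smooth_on_frechet_derivative[OF S] in_S[OF _ _ t]] \<xi> by (intro line) auto
  qed
  then obtain \<eta> where \<eta>: "0 < \<eta>" "\<eta> < h" and eq2: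
    "?D (x + \<xi> *\<^sub>R v + h *\<^sub>R w) - ?D (x + \<xi> *\<^sub>R v) = h * frechet_derivative ?D (at (x + \<xi> *\<^sub>R v + \<eta> *\<^sub>R w)) w"
    by auto
  show ?thesis
    using near[of \<xi> \<eta>] \<xi> \<eta> eq1 eq2 by (intro exI[of _ "x + \<xi> *\<^sub>R v + \<eta> *\<^sub>R w"]) (simp add: ac_simps)
qed

text \<open>The double difference is symmetric in \<open>v\<close> and \<open>w\<close>, so
  arbitrarily close to \<open>x\<close> there are two points where the two mixed derivatives agree.
  If they differed at \<open>x\<close>, continuity would keep each within half the gap of its value
  at \<open>x\<close>.\<close>

lemma frechet_derivative_commute:
  fixes f :: "'a::real_normed_vector \<Rightarrow> real"
  assumes "open S" "smooth_on S f" "x \<in> S"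
  shows "frechet_derivative (\<lambda>y. frechet_derivative f (at y) v) (at x) w
    = frechet_derivative (\<lambda>y. frechet_derivative f (at y) w) (at x) v"
proof (rule ccontr)
  let ?A = "\<lambda>v w x. frechet_derivative (\<lambda>y. frechet_derivative f (at y) v) (at x) w"
  assume neq: "?A v w x \<noteq> ?A w v x"
  define e where "e = \<bar>?A v w x - ?A w v x\<bar> / 2"
  have e: "e > 0"
    using neq by (simp add: e_def)
  have near: "\<exists>d>0. \<forall>y. dist y x < d \<longrightarrow> dist (?A v w y) (?A v w x) < e" for v w
  proof -
    have "isCont (?A v w) x"
      using smooth_on_continuous_on[OF smooth_on_frechet_derivative[OF smooth_on_frechet_derivative[OF assms(2)]]] assms(1,3)
      by (simp add: continuous_on_eq_continuous_at)
    then show ?thesis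
      using e unfolding continuous_at_eps_delta by blast
  qed
  obtain d1 where d1: "d1 > 0" "\<And>y. dist y x < d1 \<Longrightarrow> dist (?A v w y) (?A v w x) < e"
    using near by metis
  obtain d2 where d2: "d2 > 0" "\<And>y. dist y x < d2 \<Longrightarrow> dist (?A w v y) (?A w v x) < e"
    using near by metis
  obtain d3 where d3: "d3 > 0" "ball x d3 \<subseteq> S"
    using assms open_contains_ball by metis
  define r where "r = min d1 (min d2 d3)"
  have r: "0 < r" "ball x r \<subseteq> S"
    using d1 d2 d3 by (auto simp: r_def)
  \<comment> \<open>The summand 1 keeps the denominator positive for \<open>v = w = 0\<close> and
    makes the required inequality strict.\<close>
  define h where "h = r / (norm v + norm w + 1)"
  have pos: "norm v + norm w + 1 > 0"
    by (simp add: add_nonneg_pos)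
  have "h * norm v + h * norm w = r * (norm v + norm w) / (norm v + norm w + 1)"
    by (simp add: h_def distrib_left add_divide_distrib)
  also have "\<dots> < r"
    using pos r by (simp add: divide_less_eq)
  finally have h: "0 < h" "h * norm v + h * norm w < r"
    using pos r by (auto simp: h_def)
  obtain z1 where z1: "norm (z1 - x) \<le> h * norm v + h * norm w"
    "f (x + h *\<^sub>R v + h *\<^sub>R w) - f (x + h *\<^sub>R v) - f (x + h *\<^sub>R w) + f x = h * (h * ?A v w z1)"
    using mean_value_mixed[OF assms(2) r h] by blast
  obtain z2 where z2: "norm (z2 - x) \<le> h * norm w + h * norm v"
    "f (x + h *\<^sub>R w + h *\<^sub>R v) - f (x + h *\<^sub>R w) - f (x + h *\<^sub>R v) + f x = h * (h * ?A w v z2)"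
    using mean_value_mixed[OF assms(2) r h(1), of w v] h(2) by (auto simp: add.commute)
  have "f (x + h *\<^sub>R w + h *\<^sub>R v) = f (x + h *\<^sub>R v + h *\<^sub>R w)"
    by (simp add: ac_simps)
  then have "h * (h * ?A v w z1) = h * (h * ?A w v z2)"
    using z1(2) z2(2) by linarith
  then have eq: "?A v w z1 = ?A w v z2"
    using h by simp
  have "dist z1 x < r" "dist z2 x < r"
    using z1(1) z2(1) h(2) by (simp_all add: dist_norm)
  then have "dist (?A v w z1) (?A v w x) < e" "dist (?A w v z2) (?A w v x) < e"
    using d1(2) d2(2) by (simp_all add: r_def)
  then show False
    unfolding eq e_def dist_real_def by argo
qed


section \<open>The ring of germs at the origin\<close>

definition germ_rel :: "('a::real_normed_vector \<Rightarrow> real) \<Rightarrow> ('a \<Rightarrow> real) \<Rightarrow> bool" where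
  "germ_rel f f' \<longleftrightarrow> (\<exists>S. open S \<and> 0 \<in> S \<and> smooth_on S f \<and> smooth_on S f' \<and> (\<forall>x\<in>S. f x = f' x))"

lemma germ_relE:
  assumes "germ_rel f f'" "germ_rel k k'"
  obtains S where "open S" "0 \<in> S" "smooth_on S f" "smooth_on S f'" "\<And>x. x \<in> S \<Longrightarrow> f x = f' x"
    "smooth_on S k" "smooth_on S k'" "\<And>x. x \<in> S \<Longrightarrow> k x = k' x"
proof -
  obtain S T where ST: "open S" "0 \<in> S" "smooth_on S f" "smooth_on S f'" "\<forall>x\<in>S. f x = f' x"
    "open T" "0 \<in> T" "smooth_on T k" "smooth_on T k'" "\<forall>x\<in>T. k x = k' x"
    using assms unfolding germ_rel_def by metis
  show ?thesis
    by (rule that[of "S \<inter> T"]) (use ST in \<open>auto intro: smooth_on_subset\<close>)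
qed

lemma germ_relI: "open S \<Longrightarrow> 0 \<in> S \<Longrightarrow> smooth_on S f \<Longrightarrow> (\<And>x. x \<in> S \<Longrightarrow> f x = f' x) \<Longrightarrow> germ_rel f f'"
  unfolding germ_rel_def using smooth_on_cong by blast

lemma germ_rel_const: "germ_rel (\<lambda>x. c) (\<lambda>x. c)"
  unfolding germ_rel_def by (intro exI[of _ UNIV]) (simp add: smooth_on_const)

\<comment> \<open>The relation is reflexive exactly at the functions that are smooth near 0, so a
  partial quotient is taken. The base point is fixed at the origin, which keeps the type free of a
  point parameter.\<close>
quotient_type (overloaded) 'a germ = "'a::real_normed_vector \<Rightarrow> real" / partial: germ_rel
proof (rule part_equivpI)
  show "\<exists>x. germ_rel x (x :: 'a \<Rightarrow> real)"
    using germ_rel_const by blast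
  show "symp (germ_rel :: ('a \<Rightarrow> real) \<Rightarrow> _)"
    by (rule sympI) (auto simp: germ_rel_def)
  show "transp (germ_rel :: ('a \<Rightarrow> real) \<Rightarrow> _)"
  proof (rule transpI)
    fix f k l :: "'a \<Rightarrow> real"
    assume "germ_rel f k" "germ_rel k l"
    then obtain S where "open S" "0 \<in> S" "smooth_on S f" "\<And>x. x \<in> S \<Longrightarrow> f x = k x" "smooth_on S l" "\<And>x. x \<in> S \<Longrightarrow> k x = l x"
      by (rule germ_relE) metis
    then show "germ_rel f l"
      unfolding germ_rel_def by force
  qed
qed

lemma germ_rel_add:
  assumes "germ_rel f f'" "germ_rel k k'"
  shows "germ_rel (\<lambda>x. f x + k x) (\<lambda>x. f' x + k' x)"
  using assms by (rule germ_relE) (rule germ_relI, auto intro: smooth_on_add)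

lemma germ_rel_mult:
  assumes "germ_rel f f'" "germ_rel k k'"
  shows "germ_rel (\<lambda>x. f x * k x) (\<lambda>x. f' x * k' x)"
  using assms by (rule germ_relE) (rule germ_relI, auto intro: smooth_on_mult)

lemma germ_rel_uminus:
  assumes "germ_rel f f'"
  shows "germ_rel (\<lambda>x. - f x) (\<lambda>x. - f' x)"
  using assms assms by (rule germ_relE) (rule germ_relI, auto intro: smooth_on_uminus)

lemma germ_rel_deriv:
  assumes "germ_rel f f'"
  shows "germ_rel (\<lambda>x. frechet_derivative f (at x) v) (\<lambda>x. frechet_derivative f' (at x) v)"
proof -
  obtain S where S: "open S" "0 \<in> S" "smooth_on S f" "smooth_on S f'" "\<And>x. x \<in> S \<Longrightarrow> f x = f' x"
    using germ_relE[OF assms assms] by metis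
  have "frechet_derivative f (at x) v = frechet_derivative f' (at x) v" if "x \<in> S" for x
    using frechet_derivative_transform_within_open[OF smooth_on_differentiable[OF S(3) that] S(1) that S(5)] by simp
  then show ?thesis
    unfolding germ_rel_def using S smooth_on_frechet_derivative by blast
qed

lemma germ_rel_eqI: "germ_rel f f \<Longrightarrow> (\<And>x. f x = f' x) \<Longrightarrow> germ_rel f f'"
  by (metis ext)

instantiation germ :: (real_normed_vector) comm_ring_1
begin

lift_definition zero_germ :: "'a germ" is "\<lambda>_. 0"
  by (rule germ_rel_const)

lift_definition one_germ :: "'a germ" is "\<lambda>_. 1"
  by (rule germ_rel_const)

lift_definition plus_germ :: "'a germ \<Rightarrow> 'a germ \<Rightarrow> 'a germ" is "\<lambda>f k x. f x + k x"
  by (rule germ_rel_add)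

lift_definition times_germ :: "'a germ \<Rightarrow> 'a germ \<Rightarrow> 'a germ" is "\<lambda>f k x. f x * k x"
  by (rule germ_rel_mult)

lift_definition uminus_germ :: "'a germ \<Rightarrow> 'a germ" is "\<lambda>f x. - f x"
  by (rule germ_rel_uminus)

definition minus_germ :: "'a germ \<Rightarrow> 'a germ \<Rightarrow> 'a germ" where
  "minus_germ a b = a + - b"

instance
proof
  fix a b c :: "'a germ"
  note ops = germ_rel_add germ_rel_mult germ_rel_uminus germ_rel_const
  show "a + b + c = a + (b + c)"
    by transfer (rule germ_rel_eqI, (intro ops; assumption), simp)
  show "a + b = b + a"
    by transfer (rule germ_rel_eqI, (intro ops; assumption), simp)
  show "0 + a = a"
    by transfer (rule germ_rel_eqI, (intro ops; assumption), simp)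
  show "- a + a = 0"
    by transfer (rule germ_rel_eqI, (intro ops; assumption), simp)
  show "a - b = a + - b"
    by (rule minus_germ_def)
  show "a * b * c = a * (b * c)"
    by transfer (rule germ_rel_eqI, (intro ops; assumption), simp)
  show "a * b = b * a"
    by transfer (rule germ_rel_eqI, (intro ops; assumption), simp)
  show "1 * a = a"
    by transfer (rule germ_rel_eqI, (intro ops; assumption), simp)
  show "(a + b) * c = a * c + b * c"
    by transfer (rule germ_rel_eqI, (intro ops; assumption), simp add: algebra_simps)
  show "(0 :: 'a germ) \<noteq> 1"
    by transfer (auto simp: germ_rel_def)
qed

end

lift_definition germ_const :: "real \<Rightarrow> 'a::real_normed_vector germ" is "\<lambda>c _. c"
  by (rule germ_rel_const)

lift_definition germ_value :: "'a::real_normed_vector germ \<Rightarrow> real" is "\<lambda>f. f 0"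
  by (auto simp: germ_rel_def)

lift_definition germ_deriv :: "'a::real_normed_vector \<Rightarrow> 'a germ \<Rightarrow> 'a germ" is
  "\<lambda>v f x. frechet_derivative f (at x) v"
  by (rule germ_rel_deriv)

lemma germ_const_0: "germ_const 0 = 0"
  by transfer (rule germ_rel_const)

lemma germ_const_1: "germ_const 1 = 1"
  by transfer (rule germ_rel_const)

lemma germ_const_add: "germ_const (a + b) = germ_const a + germ_const b"
  by transfer (rule germ_rel_const)

lemma germ_const_mult: "germ_const (a * b) = germ_const a * germ_const b"
  by transfer (rule germ_rel_const)

lemma germ_const_diff: "germ_const (a - b) = germ_const a - germ_const b"
  by (metis germ_const_add add_diff_cancel diff_add_cancel)

lemma germ_value_simps:
  "germ_value (a + b) = germ_value a + germ_value b"
  "germ_value (a * b) = germ_value a * germ_value b"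
  "germ_value (- a) = - germ_value a"
  "germ_value (a - b) = germ_value a - germ_value b"
  "germ_value 0 = 0" "germ_value 1 = 1" "germ_value (germ_const c) = c"
proof -
  show 1: "germ_value (a + b) = germ_value a + germ_value b" for a b :: "'a germ"
    by transfer simp
  show 2: "germ_value (- a) = - germ_value a" for a :: "'a germ"
    by transfer simp
  show "germ_value (a - b) = germ_value a - germ_value b"
    unfolding minus_germ_def 1 2 by simp
qed (transfer, simp)+

lemma germ_value_sum: "germ_value (\<Sum>x\<in>A. a x) = (\<Sum>x\<in>A. germ_value (a x))"
  by (induction A rule: infinite_finite_induct) (simp_all add: germ_value_simps)

lemma germ_deriv_const: "germ_deriv v (germ_const c) = 0"
  by transfer (simp add: germ_rel_const)

lemma germ_deriv_add: "germ_deriv v (a + b) = germ_deriv v a + germ_deriv v b"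
proof transfer
  fix v :: 'a and f k :: "'a \<Rightarrow> real"
  assume *: "germ_rel f f" "germ_rel k k"
  then obtain S where S: "open S" "0 \<in> S" "smooth_on S f" "smooth_on S k"
    by (rule germ_relE) blast
  show "germ_rel (\<lambda>x. frechet_derivative (\<lambda>x. f x + k x) (at x) v) (\<lambda>x. frechet_derivative f (at x) v + frechet_derivative k (at x) v)"
  proof (rule germ_relI[OF S(1,2)])
    show "smooth_on S (\<lambda>x. frechet_derivative (\<lambda>x. f x + k x) (at x) v)"
      using S by (intro smooth_on_frechet_derivative smooth_on_add)
    show "frechet_derivative (\<lambda>x. f x + k x) (at x) v = frechet_derivative f (at x) v + frechet_derivative k (at x) v" if "x \<in> S" for x
      using frechet_derivative_eqI[OF has_derivative_add[OF smooth_on_differentiable[OF S(3) that, unfolded frechet_derivative_works]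
            smooth_on_differentiable[OF S(4) that, unfolded frechet_derivative_works]]]
      by simp
  qed
qed

lemma germ_deriv_mult: "germ_deriv v (a * b) = germ_deriv v a * b + a * germ_deriv v b"
proof transfer
  fix v :: 'a and f k :: "'a \<Rightarrow> real"
  assume *: "germ_rel f f" "germ_rel k k"
  then obtain S where S: "open S" "0 \<in> S" "smooth_on S f" "smooth_on S k"
    by (rule germ_relE) blast
  show "germ_rel (\<lambda>x. frechet_derivative (\<lambda>x. f x * k x) (at x) v) (\<lambda>x. frechet_derivative f (at x) v * k x + f x * frechet_derivative k (at x) v)"
  proof (rule germ_relI[OF S(1,2)])
    show "smooth_on S (\<lambda>x. frechet_derivative (\<lambda>x. f x * k x) (at x) v)"
      using S by (intro smooth_on_frechet_derivative smooth_on_mult)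
    show "frechet_derivative (\<lambda>x. f x * k x) (at x) v = frechet_derivative f (at x) v * k x + f x * frechet_derivative k (at x) v" if "x \<in> S" for x
      using frechet_derivative_eqI[OF has_derivative_mult[OF smooth_on_differentiable[OF S(3) that, unfolded frechet_derivative_works]
            smooth_on_differentiable[OF S(4) that, unfolded frechet_derivative_works]]]
      by (simp add: add.commute)
  qed
qed

lemma germ_deriv_commute: "germ_deriv v (germ_deriv w a) = germ_deriv w (germ_deriv v a)"
proof transfer
  fix v w :: 'a and f :: "'a \<Rightarrow> real"
  assume "germ_rel f f"
  then obtain S where S: "open S" "0 \<in> S" "smooth_on S f"
    unfolding germ_rel_def by blast
  show "germ_rel (\<lambda>x. frechet_derivative (\<lambda>x. frechet_derivative f (at x) w) (at x) v)
      (\<lambda>x. frechet_derivative (\<lambda>x. frechet_derivative f (at x) v) (at x) w)"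
    using S by (intro germ_relI[OF S(1,2)] smooth_on_frechet_derivative frechet_derivative_commute[OF S(1)])
qed

section \<open>Germs in charts\<close>

lemma germ_relI_translate:
  assumes "open S" "x \<in> S" "smooth_on S F" "\<And>y. y \<in> S \<Longrightarrow> F y = F' y"
  shows "germ_rel (\<lambda>y. F (x + y)) (\<lambda>y. F' (x + y))"
proof (rule germ_relI)
  show "open {y. x + y \<in> S}"
    using open_vimage[OF \<open>open S\<close>, of "\<lambda>y. x + y"] by (simp add: vimage_def continuous_intros)
qed (use assms in \<open>auto intro: smooth_on_translate\<close>)

text \<open>The chart is translated so that the point p becomes the origin.\<close>
definition has_germ :: "('p, 'n::finite) chart \<Rightarrow> 'p \<Rightarrow> ('p \<Rightarrow> real) \<Rightarrow> (real^'n) germ \<Rightarrow> bool" where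
  "has_germ \<kappa> p h a \<longleftrightarrow> cr_germ (\<lambda>y. in_chart \<kappa> h (coords \<kappa> p + y)) a"

lemma cr_germ_iff: "cr_germ F a \<longleftrightarrow> germ_rel F F \<and> abs_germ F = a"
  by (simp add: cr_germ_def)

lemma cr_germ_cong: "cr_germ F a \<Longrightarrow> germ_rel F F' \<Longrightarrow> cr_germ F' a"
  unfolding cr_germ_iff using Quotient3_germ
  by (metis Quotient3_def Quotient3_rel_abs)

text \<open>The transfer rules, stated with the raw correspondence \<open>cr_germ\<close>, serve as
  introduction rules that build the germ of a formula from the germs of its parts.\<close>

lemmas germ_transfers =
  germ_const.transfer[unfolded germ.pcr_cr_eq, THEN rel_funD, OF refl]
  plus_germ.transfer[unfolded germ.pcr_cr_eq, THEN rel_funD, THEN rel_funD]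
  times_germ.transfer[unfolded germ.pcr_cr_eq, THEN rel_funD, THEN rel_funD]
  uminus_germ.transfer[unfolded germ.pcr_cr_eq, THEN rel_funD]
  germ_deriv.transfer[unfolded germ.pcr_cr_eq, THEN rel_funD, THEN rel_funD, OF refl]

lemma has_germ_unique: "has_germ \<kappa> p h a \<Longrightarrow> has_germ \<kappa> p h b \<Longrightarrow> a = b"
  by (simp add: has_germ_def cr_germ_iff)

lemma has_germ_const: "has_germ \<kappa> p (\<lambda>q. c) (germ_const c)"
  unfolding has_germ_def in_chart_def o_def
  by (intro germ_transfers)

lemma has_germ_add: "has_germ \<kappa> p h a \<Longrightarrow> has_germ \<kappa> p k b \<Longrightarrow> has_germ \<kappa> p (\<lambda>q. h q + k q) (a + b)"
  unfolding has_germ_def in_chart_def o_def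
  by (intro germ_transfers)

lemma has_germ_mult: "has_germ \<kappa> p h a \<Longrightarrow> has_germ \<kappa> p k b \<Longrightarrow> has_germ \<kappa> p (\<lambda>q. h q * k q) (a * b)"
  unfolding has_germ_def in_chart_def o_def
  by (intro germ_transfers)

lemma has_germ_minus: "has_germ \<kappa> p h a \<Longrightarrow> has_germ \<kappa> p (\<lambda>q. - h q) (- a)"
  unfolding has_germ_def in_chart_def o_def
  by (intro germ_transfers)

lemma has_germ_diff: "has_germ \<kappa> p h a \<Longrightarrow> has_germ \<kappa> p k b \<Longrightarrow> has_germ \<kappa> p (\<lambda>q. h q - k q) (a - b)"
  using has_germ_add[OF _ has_germ_minus, of \<kappa> p h a k b] by simp

lemma has_germ_power2: "has_germ \<kappa> p h a \<Longrightarrow> has_germ \<kappa> p (\<lambda>q. (h q)\<^sup>2) (a\<^sup>2)"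
  unfolding power2_eq_square by (rule has_germ_mult)

lemma has_germ_sum:
  "(\<And>i. i \<in> A \<Longrightarrow> has_germ \<kappa> p (h i) (a i)) \<Longrightarrow> has_germ \<kappa> p (\<lambda>q. \<Sum>i\<in>A. h i q) (\<Sum>i\<in>A. a i)"
  by (induction A rule: infinite_finite_induct)
    (use has_germ_const[of \<kappa> p 0] in \<open>auto simp: germ_const_0 intro: has_germ_add\<close>)

lemma has_germ_prod:
  "(\<And>i. i \<in> A \<Longrightarrow> has_germ \<kappa> p (h i) (a i)) \<Longrightarrow> has_germ \<kappa> p (\<lambda>q. \<Prod>i\<in>A. h i q) (\<Prod>i\<in>A. a i)"
  by (induction A rule: infinite_finite_induct)
    (use has_germ_const[of \<kappa> p 1] in \<open>auto simp: germ_const_1 intro: has_germ_mult\<close>)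

lemma has_germ_divide_const: "has_germ \<kappa> p h a \<Longrightarrow> has_germ \<kappa> p (\<lambda>q. h q / c) (germ_const (1 / c) * a)"
  using has_germ_mult[OF has_germ_const[of \<kappa> p "1 / c"], of h a] by simp

lemmas has_germ_intros = has_germ_const has_germ_add has_germ_mult has_germ_diff has_germ_power2 has_germ_sum
  has_germ_divide_const

context smooth_manifold
begin

lemma chart_dom_subset: "\<kappa> \<in> \<A> \<Longrightarrow> chart_dom \<kappa> \<subseteq> topspace X"
  using dom_open openin_subset by blast

lemma inj_on_coords: "\<kappa> \<in> \<A> \<Longrightarrow> inj_on (coords \<kappa>) (chart_dom \<kappa>)"
  using homeomorphic_imp_injective_map[OF homeomorphic] chart_dom_subset
  by (simp add: inf.absorb2)

lemma in_chart_coords: "\<kappa> \<in> \<A> \<Longrightarrow> q \<in> chart_dom \<kappa> \<Longrightarrow> in_chart \<kappa> h (coords \<kappa> q) = h q"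
  by (simp add: in_chart_def inv_into_f_f[OF inj_on_coords])

lemma open_coords_image:
  assumes "\<kappa> \<in> \<A>" "openin X W" "W \<subseteq> chart_dom \<kappa>"
  shows "open (coords \<kappa> ` W)"
proof -
  have "openin (subtopology X (chart_dom \<kappa>)) W"
    using assms dom_open by (simp add: openin_open_subtopology)
  then have "openin (top_of_set (coords \<kappa> ` chart_dom \<kappa>)) (coords \<kappa> ` W)"
    using homeomorphic_imp_open_map[OF homeomorphic[OF assms(1)]] by (simp add: open_map_def)
  then show ?thesis
    using image_open[OF assms(1)] openin_open_trans by blast
qed

lemma has_germ_value:
  assumes "\<kappa> \<in> \<A>" "p \<in> chart_dom \<kappa>" "has_germ \<kappa> p h a"
  shows "germ_value a = h p"
proof -
  have "germ_value a = in_chart \<kappa> h (coords \<kappa> p + 0)"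
    using germ_value.transfer[unfolded germ.pcr_cr_eq, THEN rel_funD, OF assms(3)[unfolded has_germ_def]] by simp
  then show ?thesis
    using in_chart_coords assms by simp
qed

lemma has_germ_smooth:
  assumes "\<kappa> \<in> \<A>" "openin X W" "W \<subseteq> chart_dom \<kappa>" "p \<in> W" "smooth_on (coords \<kappa> ` W) (in_chart \<kappa> h)"
  shows "\<exists>a. has_germ \<kappa> p h a"
  unfolding has_germ_def cr_germ_iff
  using germ_relI_translate[OF open_coords_image[OF assms(1-3)] _ assms(5)] assms(4) by auto

lemma has_germ_nhd:
  assumes "\<kappa> \<in> \<A>" "openin X W" "W \<subseteq> chart_dom \<kappa>" "p \<in> W" "has_germ \<kappa> p h a"
  obtains S where "open S" "coords \<kappa> p \<in> S" "S \<subseteq> coords \<kappa> ` W" "smooth_on S (in_chart \<kappa> h)"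
proof -
  obtain T where T: "open T" "0 \<in> T" "smooth_on T (\<lambda>y. in_chart \<kappa> h (coords \<kappa> p + y))"
    using assms(5) unfolding has_germ_def cr_germ_iff germ_rel_def by blast
  have "open {y. - coords \<kappa> p + y \<in> T}"
    using open_vimage[OF \<open>open T\<close>, of "\<lambda>y. - coords \<kappa> p + y"] by (simp add: vimage_def continuous_intros)
  moreover have "smooth_on {y. - coords \<kappa> p + y \<in> T} (in_chart \<kappa> h)"
    using smooth_on_translate[OF T(1,3), of "- coords \<kappa> p"] by simp
  ultimately show ?thesis
    using T(2) assms(4) open_coords_image[OF assms(1-3)]
    by (intro that[of "{y. - coords \<kappa> p + y \<in> T} \<inter> coords \<kappa> ` W"]) (auto intro: smooth_on_subset)
qed

text \<open>Agreement on an open set around \<open>p\<close> inside the chart domain is enough, as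
  only the coordinates near \<open>coords \<kappa> p\<close> matter.\<close>

lemma has_germ_cong:
  assumes "\<kappa> \<in> \<A>" "openin X W" "W \<subseteq> chart_dom \<kappa>" "p \<in> W" "\<And>q. q \<in> W \<Longrightarrow> h q = h' q" "has_germ \<kappa> p h a"
  shows "has_germ \<kappa> p h' a"
proof -
  obtain S where S: "open S" "coords \<kappa> p \<in> S" "S \<subseteq> coords \<kappa> ` W" "smooth_on S (in_chart \<kappa> h)"
    using has_germ_nhd[OF assms(1-4,6)] .
  have "in_chart \<kappa> h y = in_chart \<kappa> h' y" if "y \<in> S" for y
  proof -
    obtain q where "q \<in> W" "y = coords \<kappa> q"
      using \<open>y \<in> S\<close> S(3) by blast
    then show ?thesis
      using assms(3,5) by (auto simp: in_chart_coords[OF assms(1)])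
  qed
  then show ?thesis
    using assms(6) germ_relI_translate[OF S(1,2,4)] unfolding has_germ_def by (blast intro: cr_germ_cong)
qed

lemma has_germ_differentiable:
  assumes "\<kappa> \<in> \<A>" "p \<in> chart_dom \<kappa>" "has_germ \<kappa> p h a"
  shows "in_chart \<kappa> h differentiable at (coords \<kappa> p)"
  using has_germ_nhd[OF assms(1) dom_open[OF assms(1)] order_refl assms(2,3)] smooth_on_differentiable by metis

text \<open>Translation commutes with differentiation. The comparison is made on a whole
  neighbourhood, where every point is the coordinate of a point of the chart and
  \<open>coord_deriv\<close> is the actual partial derivative.\<close>

lemma has_germ_deriv:
  assumes "\<kappa> \<in> \<A>" "p \<in> chart_dom \<kappa>" "has_germ \<kappa> p h a"
  shows "has_germ \<kappa> p (coord_deriv \<kappa> i h) (germ_deriv (axis i 1) a)"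
proof -
  let ?x = "coords \<kappa> p" and ?F = "in_chart \<kappa> h"
  obtain S where S: "open S" "?x \<in> S" "S \<subseteq> coords \<kappa> ` chart_dom \<kappa>" "smooth_on S ?F"
    using has_germ_nhd[OF assms(1) dom_open[OF assms(1)] order_refl assms(2,3)] .
  have "cr_germ (\<lambda>y. frechet_derivative (\<lambda>y. ?F (?x + y)) (at y) (axis i 1)) (germ_deriv (axis i 1) a)"
    using assms(3) unfolding has_germ_def by (rule germ_transfers)
  moreover have "germ_rel (\<lambda>y. frechet_derivative (\<lambda>y. ?F (?x + y)) (at y) (axis i 1)) (\<lambda>y. in_chart \<kappa> (coord_deriv \<kappa> i h) (?x + y))"
  proof (rule germ_relI)
    show "open {y. ?x + y \<in> S}"
      using open_vimage[OF \<open>open S\<close>, of "\<lambda>y. ?x + y"] by (simp add: vimage_def continuous_intros)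
    show "smooth_on {y. ?x + y \<in> S} (\<lambda>y. frechet_derivative (\<lambda>y. ?F (?x + y)) (at y) (axis i 1))"
      using smooth_on_frechet_derivative[OF smooth_on_translate[OF S(1,4)]] .
    fix y assume y: "y \<in> {y. ?x + y \<in> S}"
    then obtain q where q: "q \<in> chart_dom \<kappa>" "?x + y = coords \<kappa> q"
      using S(3) by auto
    have "frechet_derivative (\<lambda>y. ?F (?x + y)) (at y) = frechet_derivative ?F (at (?x + y))"
    proof (rule frechet_derivative_eqI)
      have "(?F has_derivative frechet_derivative ?F (at (?x + y))) (at (?x + y))"
        using smooth_on_differentiable[OF S(4)] y by (simp add: frechet_derivative_works[symmetric])
      moreover have "((\<lambda>y. ?x + y) has_derivative (\<lambda>v. v)) (at y)"
        by (auto intro!: derivative_eq_intros)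
      ultimately show "((\<lambda>y. ?F (?x + y)) has_derivative frechet_derivative ?F (at (?x + y))) (at y)"
        using has_derivative_compose[of "\<lambda>y. ?x + y" "\<lambda>v. v" y UNIV ?F] by simp
    qed
    then show "frechet_derivative (\<lambda>y. ?F (?x + y)) (at y) (axis i 1) = in_chart \<kappa> (coord_deriv \<kappa> i h) (?x + y)"
      by (simp add: q in_chart_coords[OF assms(1)] coord_deriv_def)
  qed (use S in auto)
  ultimately show ?thesis
    unfolding has_germ_def by (rule cr_germ_cong)
qed

lemma has_germ_inverse:
  assumes "\<kappa> \<in> \<A>" "p \<in> chart_dom \<kappa>" "has_germ \<kappa> p h a" "h p \<noteq> 0"
  shows "\<exists>b. has_germ \<kappa> p (\<lambda>q. inverse (h q)) b"
proof -
  let ?F = "in_chart \<kappa> h"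
  obtain S where S: "open S" "coords \<kappa> p \<in> S" "S \<subseteq> coords \<kappa> ` chart_dom \<kappa>" "smooth_on S ?F"
    using has_germ_nhd[OF assms(1) dom_open[OF assms(1)] order_refl assms(2,3)] .
  let ?T = "S \<inter> ?F -` (- {0})"
  have "open ?T"
    by (rule continuous_open_preimage[OF smooth_on_continuous_on[OF S(4)] S(1)]) (simp add: open_Compl)
  moreover have "coords \<kappa> p \<in> ?T"
    using S(2) assms by (simp add: in_chart_coords)
  moreover have "smooth_on ?T (\<lambda>y. inverse (?F y))"
    using \<open>open ?T\<close> smooth_on_subset[OF S(4), of ?T] by (intro smooth_on_inverse) auto
  ultimately have "germ_rel (\<lambda>y. inverse (?F (coords \<kappa> p + y))) (\<lambda>y. inverse (?F (coords \<kappa> p + y)))"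
    using germ_relI_translate[of ?T "coords \<kappa> p" "\<lambda>y. inverse (?F y)" "\<lambda>y. inverse (?F y)"] by blast
  then show ?thesis
    unfolding has_germ_def cr_germ_iff in_chart_def o_def by blast
qed

lemma has_germ_coordinate:
  assumes "\<kappa> \<in> \<A>" "\<kappa>' \<in> \<A>" "p \<in> chart_dom \<kappa> \<inter> chart_dom \<kappa>'"
  shows "\<exists>a. has_germ \<kappa> p (\<lambda>q. coords \<kappa>' q $ i) a"
proof (rule has_germ_smooth[OF assms(1) _ _ assms(3)])
  have W: "openin X (chart_dom \<kappa> \<inter> chart_dom \<kappa>')"
    using assms dom_open by blast
  then show "openin X (chart_dom \<kappa> \<inter> chart_dom \<kappa>')" .
  show "smooth_on (coords \<kappa> ` (chart_dom \<kappa> \<inter> chart_dom \<kappa>')) (in_chart \<kappa> (\<lambda>q. coords \<kappa>' q $ i))"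
    using smooth_on_bounded_linear[OF open_coords_image[OF assms(1) W] bounded_linear_vec_nth transition[OF assms(1,2)], of i]
    by (simp add: in_chart_def o_def)
qed simp

text \<open>The chain rule: \<open>h\<close> in the chart \<kappa> is \<open>h\<close> in the chart
  \<kappa>' composed with the transition map, whose derivative is then expanded in the standard
  basis.\<close>

lemma coord_deriv_change:
  assumes "\<kappa> \<in> \<A>" "\<kappa>' \<in> \<A>" "p \<in> chart_dom \<kappa> \<inter> chart_dom \<kappa>'" "has_germ \<kappa>' p h a"
  shows "coord_deriv \<kappa> i h p = (\<Sum>j\<in>UNIV. coord_deriv \<kappa> i (\<lambda>q. coords \<kappa>' q $ j) p * coord_deriv \<kappa>' j h p)"
proof -
  let ?W = "chart_dom \<kappa> \<inter> chart_dom \<kappa>'" and ?x = "coords \<kappa> p" and ?T = "in_chart \<kappa> (coords \<kappa>')"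
  let ?F = "in_chart \<kappa>' h"
  have W: "open (coords \<kappa> ` ?W)"
    using assms(1,2) dom_open by (intro open_coords_image openin_Int) auto
  have x: "?x \<in> coords \<kappa> ` ?W"
    using assms by blast
  have Tx: "?T ?x = coords \<kappa>' p"
    using assms by (simp add: in_chart_coords)
  define DT where "DT = frechet_derivative ?T (at ?x)"
  have T: "(?T has_derivative DT) (at ?x)"
    unfolding DT_def using smooth_on_differentiable[OF transition[OF assms(1,2)] x] by (simp add: frechet_derivative_works)
  define DF where "DF = frechet_derivative ?F (at (coords \<kappa>' p))"
  have F: "(?F has_derivative DF) (at (?T ?x))"
    unfolding DF_def Tx using has_germ_differentiable[OF assms(2) _ assms(4)] assms(3) by (simp add: frechet_derivative_works)
  have "(in_chart \<kappa> h has_derivative (\<lambda>v. DF (DT v))) (at ?x)"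
  proof (rule has_derivative_transform_within_open[OF has_derivative_compose[OF T F] W x])
    fix y assume "y \<in> coords \<kappa> ` ?W"
    then obtain q where "q \<in> ?W" "y = coords \<kappa> q"
      by blast
    then show "?F (?T y) = in_chart \<kappa> h y"
      by (simp add: in_chart_coords assms(1,2))
  qed
  then have 1: "coord_deriv \<kappa> i h p = DF (DT (axis i 1))"
    unfolding coord_deriv_def by (simp add: frechet_derivative_eqI)
  have 2: "coord_deriv \<kappa> i (\<lambda>q. coords \<kappa>' q $ j) p = DT (axis i 1) $ j" for j
  proof -
    have "in_chart \<kappa> (\<lambda>q. coords \<kappa>' q $ j) = (\<lambda>y. ?T y $ j)"
      by (simp add: in_chart_def o_def)
    then show ?thesis
      unfolding coord_deriv_def
      using frechet_derivative_eqI[OF bounded_linear.has_derivative[OF bounded_linear_vec_nth T, of j]] by simp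
  qed
  have 3: "coord_deriv \<kappa>' j h p = DF (axis j 1)" for j
    by (simp add: coord_deriv_def DF_def)
  have lin: "linear DF"
    using F has_derivative_bounded_linear bounded_linear.linear by blast
  have "DT (axis i 1) = (\<Sum>j\<in>UNIV. (DT (axis i 1) $ j) *\<^sub>R axis j 1)"
    by (simp add: vec_eq_iff axis_def if_distrib cong: if_cong)
  then have "DF (DT (axis i 1)) = DF (\<Sum>j\<in>UNIV. (DT (axis i 1) $ j) *\<^sub>R axis j 1)"
    by simp
  also have "\<dots> = (\<Sum>j\<in>UNIV. (DT (axis i 1) $ j) * DF (axis j 1))"
    using lin by (simp add: linear_sum linear_cmul)
  finally show ?thesis
    unfolding 1 2 3 .
qed

end

section \<open>The Levi-Civita calculus of a chart\<close>

lemma matrix_inv_works: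
  fixes A :: "real^'n^'n"
  assumes "invertible A"
  shows "A ** matrix_inv A = mat 1" "matrix_inv A ** A = mat 1"
proof -
  have "\<exists>B. A ** B = mat 1 \<and> B ** A = mat 1"
    using assms by (simp add: invertible_def)
  from someI_ex[OF this] show "A ** matrix_inv A = mat 1" "matrix_inv A ** A = mat 1"
    unfolding matrix_inv_def by blast+
qed

lemma matrix_inv_eqI:
  fixes A B :: "real^'n^'n"
  assumes "A ** B = mat 1"
  shows "matrix_inv A = B"
proof -
  have "B ** A = mat 1"
    using assms matrix_left_right_inverse by blast
  then have "invertible A"
    using assms invertible_def by blast
  have "matrix_inv A = matrix_inv A ** (A ** B)"
    using assms by simp
  also have "\<dots> = B"
    using matrix_inv_works(2)[OF \<open>invertible A\<close>] by (simp add: matrix_mul_assoc)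
  finally show ?thesis .
qed

text \<open>Cramer's rule writes the entries of the inverse through determinants, which are
  polynomials in the entries of \<open>A\<close>. This is what gives the inverse metric smooth
  components.\<close>

lemma matrix_inv_cramer:
  fixes A :: "real^'n^'n"
  assumes "invertible A"
  shows "matrix_inv A $ k $ l = det (\<chi> i j. if j = k then axis l 1 $ i else A $ i $ j) * inverse (det A)"
proof -
  have "A *v (matrix_inv A *v axis l 1) = axis l 1"
    using matrix_inv_works(1)[OF assms] by (simp add: matrix_vector_mul_assoc)
  moreover have "det A \<noteq> 0"
    using assms invertible_det_nz by blast
  ultimately have "matrix_inv A *v axis l 1 = (\<chi> k. det (\<chi> i j. if j = k then axis l 1 $ i else A $ i $ j) / det A)"
    using cramer by blast
  moreover have "(matrix_inv A *v axis l 1) $ k = matrix_inv A $ k $ l"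
    by (simp add: matrix_vector_mult_basis column_def)
  ultimately show ?thesis
    by (simp add: divide_inverse)
qed

lemma has_germ_det:
  assumes "\<And>i j. \<exists>a. has_germ \<kappa> p (\<lambda>q. A q $ i $ j) a"
  shows "\<exists>a. has_germ \<kappa> p (\<lambda>q. det (A q :: real^'m^'m)) a"
proof -
  obtain a where a: "\<And>i j. has_germ \<kappa> p (\<lambda>q. A q $ i $ j) (a i j)"
    using assms by metis
  show ?thesis
    unfolding det_def
    by (rule exI[of _ "\<Sum>\<sigma> | \<sigma> permutes UNIV. germ_const (of_int (sign \<sigma>)) * (\<Prod>i\<in>UNIV. a i (\<sigma> i))"])
      (intro has_germ_sum has_germ_mult has_germ_const has_germ_prod a)
qed

abbreviation partial :: "'n::finite \<Rightarrow> (real^'n) germ \<Rightarrow> (real^'n) germ" where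
  "partial i \<equiv> germ_deriv (axis i 1)"

text \<open>Specified only for functions that are smooth near \<open>p\<close> in the chart; for
  these the germ is unique.\<close>

definition germ_at :: "('p, 'n::finite) chart \<Rightarrow> 'p \<Rightarrow> ('p \<Rightarrow> real) \<Rightarrow> (real^'n) germ" where
  "germ_at \<kappa> p h = (THE a. has_germ \<kappa> p h a)"

lemma has_germ_at: "\<exists>a. has_germ \<kappa> p h a \<Longrightarrow> has_germ \<kappa> p h (germ_at \<kappa> p h)"
  unfolding germ_at_def by (metis has_germ_unique theI)

definition grad_prod :: "('p, 'n::finite) metric \<Rightarrow> ('p, 'n) chart \<Rightarrow> ('p \<Rightarrow> real) \<Rightarrow> ('p \<Rightarrow> real) \<Rightarrow> 'p \<Rightarrow> real" where
  "grad_prod g \<kappa> u v p = metric_inner g \<kappa> p (gradient g \<kappa> u p) (gradient g \<kappa> v p)"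

context riemannian_manifold
begin

lemma metric_invertible:
  assumes "\<kappa> \<in> \<A>" "p \<in> chart_dom \<kappa>"
  shows "invertible (g \<kappa> p)"
proof -
  have "v = 0" if "g \<kappa> p *v v = 0" for v
    using metric_pos[OF assms, of v] that by force
  then have "\<exists>B. B ** g \<kappa> p = mat 1"
    using matrix_left_invertible_ker by blast
  then show ?thesis
    using invertible_left_inverse by blast
qed

lemmas metric_inv = matrix_inv_works[OF metric_invertible]

lemma metric_inv_sym:
  assumes "\<kappa> \<in> \<A>" "p \<in> chart_dom \<kappa>"
  shows "transpose (matrix_inv (g \<kappa> p)) = matrix_inv (g \<kappa> p)"
proof -
  have "transpose (matrix_inv (g \<kappa> p) ** g \<kappa> p) = mat 1"
    using metric_inv(2)[OF assms] by simp
  then have "g \<kappa> p ** transpose (matrix_inv (g \<kappa> p)) = mat 1"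
    by (simp add: matrix_transpose_mul metric_sym[OF assms])
  then show ?thesis
    using matrix_inv_eqI by metis
qed

lemma grad_prod_eq:
  assumes "\<kappa> \<in> \<A>" "p \<in> chart_dom \<kappa>"
  shows "grad_prod g \<kappa> u v p = differential \<kappa> u p \<bullet> (matrix_inv (g \<kappa> p) *v differential \<kappa> v p)"
proof -
  have "gradient g \<kappa> u p \<bullet> w = differential \<kappa> u p \<bullet> (matrix_inv (g \<kappa> p) *v w)" for w
    unfolding gradient_def
    by (metis assms dot_lmul_matrix metric_inv_sym transpose_matrix_vector)
  moreover have "matrix_inv (g \<kappa> p) *v (g \<kappa> p *v w) = w" for w
    by (simp add: matrix_vector_mul_assoc metric_inv[OF assms])
  ultimately show ?thesis
    by (simp add: grad_prod_def metric_inner_def) (simp add: gradient_def)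
qed

lemma metric_norm_gradient:
  assumes "\<kappa> \<in> \<A>" "p \<in> chart_dom \<kappa>"
  shows "(metric_norm g \<kappa> p (gradient g \<kappa> u p))\<^sup>2 = grad_prod g \<kappa> u u p"
proof -
  have "metric_inner g \<kappa> p w w \<ge> 0" for w
    using metric_pos[OF assms, of w] unfolding metric_inner_def by (cases "w = 0") auto
  then show ?thesis
    by (simp add: metric_norm_def grad_prod_def)
qed

end

section \<open>Metric, connection and curvature as germs at a point of a chart\<close>

locale chart_point = riemannian_manifold X \<A> g
  for X :: "'p topology" and \<A> :: "('p, 'n::finite) chart set" and g :: "('p, 'n) metric" +
  fixes \<kappa> :: "('p, 'n) chart" and p :: 'p
  assumes chart: "\<kappa> \<in> \<A>" and point: "p \<in> chart_dom \<kappa>"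
begin

abbreviation "G i j \<equiv> germ_at \<kappa> p (\<lambda>q. g \<kappa> q $ i $ j)"
abbreviation "H i j \<equiv> germ_at \<kappa> p (\<lambda>q. matrix_inv (g \<kappa> q) $ i $ j)"
abbreviation "Ga k i j \<equiv> germ_at \<kappa> p (christoffel g \<kappa> k i j)"

lemmas at_point = has_germ_value[OF chart point]
lemmas has_germ_coord_deriv = has_germ_deriv[OF chart point]
lemmas has_germ_cong_chart = has_germ_cong[OF chart dom_open[OF chart] order_refl point]

text \<open>The bridge from the manifold to the ring: two formulas that agree on the chart domain
  have equal germs, so an identity of functions becomes an equation in the ring.\<close>

lemma germ_cong_unique:
  "has_germ \<kappa> p h a \<Longrightarrow> has_germ \<kappa> p h' b \<Longrightarrow> (\<And>q. q \<in> chart_dom \<kappa> \<Longrightarrow> h q = h' q) \<Longrightarrow> a = b"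
  by (rule has_germ_unique[OF has_germ_cong_chart[of h h']])

lemma has_germ_metric: "has_germ \<kappa> p (\<lambda>q. g \<kappa> q $ i $ j) (G i j)"
  using has_germ_smooth[OF chart dom_open[OF chart] order_refl point metric_smooth[OF chart]]
  by (rule has_germ_at)

lemma has_germ_metric_inv: "has_germ \<kappa> p (\<lambda>q. matrix_inv (g \<kappa> q) $ k $ l) (H k l)"
proof (rule has_germ_at)
  have nz: "det (g \<kappa> p) \<noteq> 0"
    using metric_invertible[OF chart point] invertible_det_nz by blast
  have ex: "\<exists>a. has_germ \<kappa> p (\<lambda>q. g \<kappa> q $ i $ j) a" for i j
    using has_germ_metric by blast
  obtain b where b: "has_germ \<kappa> p (\<lambda>q. inverse (det (g \<kappa> q))) b"
    using has_germ_inverse[OF chart point, of "\<lambda>q. det (g \<kappa> q)", OF _ nz] has_germ_det[of \<kappa> p "g \<kappa>", OF ex] by blast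
  have "\<exists>a. has_germ \<kappa> p (\<lambda>q. (\<chi> i j. if j = k then axis l 1 $ i else g \<kappa> q $ i $ j) $ i $ j) a" for i j
    using ex[of i j] by (cases "j = k") (auto intro: has_germ_const)
  then obtain a where "has_germ \<kappa> p (\<lambda>q. det (\<chi> i j. if j = k then axis l 1 $ i else g \<kappa> q $ i $ j)) a"
    using has_germ_det[of \<kappa> p "\<lambda>q. \<chi> i j. if j = k then axis l 1 $ i else g \<kappa> q $ i $ j"] by blast
  from has_germ_mult[OF this b]
  have "has_germ \<kappa> p (\<lambda>q. matrix_inv (g \<kappa> q) $ k $ l) (a * b)"
    by (rule has_germ_cong_chart[rotated]) (simp add: matrix_inv_cramer[OF metric_invertible[OF chart]])
  then show "\<exists>a. has_germ \<kappa> p (\<lambda>q. matrix_inv (g \<kappa> q) $ k $ l) a"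
    by blast
qed

lemma has_germ_christoffel_formula:
  "has_germ \<kappa> p (christoffel g \<kappa> k i j)
     (germ_const (1 / 2) * (\<Sum>l\<in>UNIV. H k l * (partial i (G j l) + partial j (G i l) - partial l (G i j))))"
  unfolding christoffel_def by (intro has_germ_intros has_germ_metric_inv has_germ_coord_deriv has_germ_metric)

lemma has_germ_christoffel: "has_germ \<kappa> p (christoffel g \<kappa> k i j) (Ga k i j)"
  by (rule has_germ_at) (rule exI, rule has_germ_christoffel_formula)

sublocale commuting_derivations "partial :: 'n \<Rightarrow> _"
  by unfold_locales (rule germ_deriv_add germ_deriv_mult germ_deriv_commute)+

text \<open>From here on every identity of the ring calculus is available for the germs at
  \<open>p\<close>; the constant germ 1/2 serves as \<open>half\<close>.\<close>

sublocale levi_civita "partial :: 'n \<Rightarrow> _" G H Ga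
proof (rule levi_civita_Koszul)
  show "G i j = G j i" for i j
  proof (rule germ_cong_unique[OF has_germ_metric has_germ_metric])
    show "g \<kappa> q $ i $ j = g \<kappa> q $ j $ i" if "q \<in> chart_dom \<kappa>" for q
      using arg_cong[OF metric_sym[OF chart that], of "\<lambda>A. A $ j $ i"] by (simp add: transpose_def)
  qed
  show "H i j = H j i" for i j
  proof (rule germ_cong_unique[OF has_germ_metric_inv has_germ_metric_inv])
    show "matrix_inv (g \<kappa> q) $ i $ j = matrix_inv (g \<kappa> q) $ j $ i" if "q \<in> chart_dom \<kappa>" for q
      using arg_cong[OF metric_inv_sym[OF chart that], of "\<lambda>A. A $ j $ i"] by (simp add: transpose_def)
  qed
  show "(\<Sum>k\<in>UNIV. H i k * G k j) = (if i = j then 1 else 0)" for i j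
  proof (rule germ_cong_unique)
    show "has_germ \<kappa> p (\<lambda>q. \<Sum>k\<in>UNIV. matrix_inv (g \<kappa> q) $ i $ k * g \<kappa> q $ k $ j) (\<Sum>k\<in>UNIV. H i k * G k j)"
      by (intro has_germ_intros has_germ_metric has_germ_metric_inv)
    show "has_germ \<kappa> p (\<lambda>q. if i = j then 1 else 0) (if i = j then 1 else 0)"
      using has_germ_const[of \<kappa> p 0] has_germ_const[of \<kappa> p 1] by (simp add: germ_const_0 germ_const_1)
    show "(\<Sum>k\<in>UNIV. matrix_inv (g \<kappa> q) $ i $ k * g \<kappa> q $ k $ j) = (if i = j then 1 else 0)" if "q \<in> chart_dom \<kappa>" for q
      using arg_cong[OF metric_inv(2)[OF chart that], of "\<lambda>A. A $ i $ j"]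
      by (simp add: matrix_matrix_mult_def mat_def)
  qed
  show "germ_const (1 / 2) + germ_const (1 / 2) = (1 :: (real^'n) germ)"
    by (metis germ_const_add germ_const_1 field_sum_of_halves)
  show "Ga k i j = germ_const (1 / 2) * (\<Sum>l\<in>UNIV. H k l * (partial i (G j l) + partial j (G i l) - partial l (G i j)))" for k i j
    using has_germ_christoffel has_germ_christoffel_formula by (rule has_germ_unique)
qed

lemma has_germ_Ric: "has_germ \<kappa> p (\<lambda>q. Ric g \<kappa> q $ i $ j) (Rc i j)"
  unfolding Ric_def Rc_def Rm_def curvature_def vec_lambda_beta
  by (intro has_germ_intros has_germ_christoffel has_germ_coord_deriv)

lemma has_germ_Hessian: "has_germ \<kappa> p u a \<Longrightarrow> has_germ \<kappa> p (\<lambda>q. Hessian g \<kappa> u q $ i $ j) (hess a i j)"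
  unfolding Hessian_def hess_def vec_lambda_beta
  by (intro has_germ_intros has_germ_christoffel has_germ_coord_deriv)

lemma has_germ_laplacian: "has_germ \<kappa> p u a \<Longrightarrow> has_germ \<kappa> p (laplacian g \<kappa> u) (tr (hess a))"
proof -
  assume "has_germ \<kappa> p u a"
  then have "has_germ \<kappa> p (laplacian g \<kappa> u) (\<Sum>i\<in>UNIV. \<Sum>k\<in>UNIV. H i k * hess a k i)"
    unfolding laplacian_def trace_def matrix_matrix_mult_def vec_lambda_beta
    by (intro has_germ_intros has_germ_metric_inv has_germ_Hessian)
  \<comment> \<open>The matrix product pairs the inverse metric with the transposed Hessian;
    symmetry of the Hessian restores the index order of \<open>tr\<close>.\<close>
  then show ?thesis
    unfolding tr_def by (simp add: hess_sym)
qed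

lemma has_germ_grad_prod:
  assumes "has_germ \<kappa> p u a" "has_germ \<kappa> p v b"
  shows "has_germ \<kappa> p (grad_prod g \<kappa> u v) (grad_inner a b)"
proof (rule has_germ_cong_chart)
  show "has_germ \<kappa> p (\<lambda>q. \<Sum>j\<in>UNIV. \<Sum>k\<in>UNIV. matrix_inv (g \<kappa> q) $ j $ k * (coord_deriv \<kappa> j u q * coord_deriv \<kappa> k v q)) (grad_inner a b)"
    unfolding grad_inner_def using assms by (intro has_germ_intros has_germ_metric_inv has_germ_coord_deriv)
  show "(\<Sum>j\<in>UNIV. \<Sum>k\<in>UNIV. matrix_inv (g \<kappa> q) $ j $ k * (coord_deriv \<kappa> j u q * coord_deriv \<kappa> k v q)) = grad_prod g \<kappa> u v q"
    if "q \<in> chart_dom \<kappa>" for q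
    unfolding grad_prod_eq[OF chart that]
    by (simp add: inner_vec_def matrix_vector_mult_def differential_def sum_distrib_left mult_ac)
qed

end

section \<open>The first integral\<close>

lemma dot_matrix_vector_transpose: "(A *v x) \<bullet> y = x \<bullet> (transpose A *v y)" for A :: "real^'n^'m"
  unfolding inner_commute[of "A *v x"] dot_lmul_matrix[symmetric] transpose_matrix_vector by (rule inner_commute)

text \<open>Cyclicity of the trace. In the comparison of Laplacians the columns of \<open>J\<close>
  are the differentials of the coordinates of a second chart and \<open>A\<close> is the metric
  there.\<close>

lemma trace_congruence:
  fixes A M J :: "real^'n^'n"
  shows "(\<Sum>a\<in>UNIV. \<Sum>b\<in>UNIV. A $ a $ b * (column b J \<bullet> (M *v column a J))) = trace (J ** A ** transpose J ** M)"
proof -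
  have "column b J \<bullet> (M *v column a J) = (transpose J ** M ** J) $ b $ a" for a b
  proof -
    have "column b J \<bullet> (M *v column a J) = (J *v axis b 1) \<bullet> (M *v (J *v axis a 1))"
      by (simp add: matrix_vector_mult_basis)
    also have "\<dots> = axis b 1 \<bullet> ((transpose J ** M ** J) *v axis a 1)"
      by (simp add: dot_matrix_vector_transpose matrix_vector_mul_assoc matrix_mul_assoc del: transpose_matrix_vector)
    also have "\<dots> = (transpose J ** M ** J) $ b $ a"
      by (simp add: matrix_vector_mult_basis inner_axis' column_def)
    finally show ?thesis .
  qed
  then have "(\<Sum>a\<in>UNIV. \<Sum>b\<in>UNIV. A $ a $ b * (column b J \<bullet> (M *v column a J))) = trace (A ** (transpose J ** M ** J))"
    by (simp add: trace_def matrix_matrix_mult_def)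
  also have "\<dots> = trace ((A ** transpose J ** M) ** J)"
    by (simp add: matrix_mul_assoc)
  also have "\<dots> = trace (J ** A ** transpose J ** M)"
    by (subst trace_mul_sym) (simp add: matrix_mul_assoc)
  finally show ?thesis .
qed

definition first_integral ::
  "('p, 'n::finite) metric \<Rightarrow> real \<Rightarrow> real \<Rightarrow> ('p \<Rightarrow> real) \<Rightarrow> ('p \<Rightarrow> real) \<Rightarrow> ('p, 'n) chart \<Rightarrow> 'p \<Rightarrow> real" where
  "first_integral g lam m f \<phi> \<kappa> p = lam * (f p)\<^sup>2 + f p * laplacian g \<kappa> f p
     + (m - 1) * grad_prod g \<kappa> f f p - f p * grad_prod g \<kappa> \<phi> f p"

section \<open>Vanishing of the differential and local constancy\<close>

context smooth_manifold
begin

lemma zero_deriv_locally_constant: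
  assumes "\<kappa> \<in> \<A>" "p \<in> chart_dom \<kappa>"
    and "\<And>q. q \<in> chart_dom \<kappa> \<Longrightarrow> \<exists>a. has_germ \<kappa> q h a \<and> (\<forall>i. partial i a = 0)"
  shows "\<exists>W. openin X W \<and> p \<in> W \<and> W \<subseteq> chart_dom \<kappa> \<and> (\<forall>q\<in>W. h q = h p)"
proof -
  let ?U = "coords \<kappa> ` chart_dom \<kappa>" and ?F = "in_chart \<kappa> h"
  have der: "(?F has_derivative (\<lambda>v. 0)) (at (coords \<kappa> q))" if q: "q \<in> chart_dom \<kappa>" for q
  proof -
    obtain a where a: "has_germ \<kappa> q h a" "\<And>i. partial i a = 0"
      using assms(3)[OF q] by blast
    let ?L = "frechet_derivative ?F (at (coords \<kappa> q))"
    have F: "(?F has_derivative ?L) (at (coords \<kappa> q))"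
      using has_germ_differentiable[OF assms(1) q a(1)] by (simp add: frechet_derivative_works)
    have basis: "?L (axis i 1) = 0" for i
    proof -
      have "?L (axis i 1) = germ_value (partial i a)"
        using has_germ_value[OF assms(1) q has_germ_deriv[OF assms(1) q a(1)], of i] by (simp add: coord_deriv_def)
      then show ?thesis
        by (simp add: a(2) germ_value_simps)
    qed
    have expand: "?L v = (\<Sum>i\<in>UNIV. v $ i * ?L (axis i 1))" for v
    proof -
      have "v = (\<Sum>i\<in>UNIV. (v $ i) *\<^sub>R axis i 1)"
        by (simp add: vec_eq_iff axis_def if_distrib cong: if_cong)
      then have "?L v = ?L (\<Sum>i\<in>UNIV. (v $ i) *\<^sub>R axis i 1)"
        by simp
      then show ?thesis
        using has_derivative_linear[OF F] by (simp add: linear_sum linear_cmul)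
    qed
    have "?L = (\<lambda>v. 0)"
      by (rule ext, subst expand) (simp add: basis)
    then show ?thesis
      using F by simp
  qed
  obtain e where e: "e > 0" "ball (coords \<kappa> p) e \<subseteq> ?U"
    using image_open[OF assms(1)] assms(2) open_contains_ball by blast
  \<comment> \<open>The preimage of a coordinate ball: balls are convex, so a vanishing derivative
    forces constancy there.\<close>
  let ?W = "{q \<in> chart_dom \<kappa>. coords \<kappa> q \<in> ball (coords \<kappa> p) e}"
  have "continuous_map (subtopology X (chart_dom \<kappa>)) (top_of_set ?U) (coords \<kappa>)"
    using homeomorphic[OF assms(1)] homeomorphic_imp_continuous_map by blast
  moreover have "openin (top_of_set ?U) (ball (coords \<kappa> p) e)"
    using e by (simp add: open_openin_trans[OF image_open[OF assms(1)]])
  ultimately have "openin (subtopology X (chart_dom \<kappa>)) {q \<in> topspace (subtopology X (chart_dom \<kappa>)). coords \<kappa> q \<in> ball (coords \<kappa> p) e}"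
    by (rule openin_continuous_map_preimage)
  moreover have "topspace (subtopology X (chart_dom \<kappa>)) = chart_dom \<kappa>"
    using chart_dom_subset[OF assms(1)] by auto
  ultimately have "openin X ?W"
    using openin_trans_full dom_open[OF assms(1)] by fastforce
  moreover have "h q = h p" if "q \<in> ?W" for q
  proof -
    have "?F (coords \<kappa> q) = ?F (coords \<kappa> p)"
    proof (rule has_derivative_zero_unique[of "ball (coords \<kappa> p) e"])
      fix y assume "y \<in> ball (coords \<kappa> p) e"
      then obtain q' where "q' \<in> chart_dom \<kappa>" "y = coords \<kappa> q'"
        using e(2) by blast
      then show "(?F has_derivative (\<lambda>v. 0)) (at y within ball (coords \<kappa> p) e)"
        using der by (simp add: has_derivative_at_withinI)
    qed (use that e in auto)
    then show ?thesis
      using that assms by (simp add: in_chart_coords)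
  qed
  moreover have "p \<in> ?W" "?W \<subseteq> chart_dom \<kappa>"
    using assms(2) e(1) by auto
  ultimately show ?thesis
    by blast
qed

end

context chart_point
begin

lemma has_germ_first_integral:
  assumes "has_germ \<kappa> p f a" "has_germ \<kappa> p \<phi> b"
  shows "has_germ \<kappa> p (first_integral g lam m f \<phi> \<kappa>)
    (germ_const lam * a\<^sup>2 + a * tr (hess a) + (germ_const m - 1) * grad_inner a a - a * grad_inner b a)"
  unfolding first_integral_def germ_const_1[symmetric] germ_const_diff[symmetric]
  using assms by (intro has_germ_intros has_germ_laplacian has_germ_grad_prod)

text \<open>Turns the hypotheses into equations of germs, componentwise for the first one, and
  applies \<open>soliton_first_integral\<close>. They are required on the whole chart domain because
  they get differentiated.\<close>

lemma first_integral_deriv: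
  assumes a: "has_germ \<kappa> p f a" and b: "has_germ \<kappa> p \<phi> b"
    and f: "\<And>q. q \<in> chart_dom \<kappa> \<Longrightarrow> f q \<noteq> 0" and m: "m \<noteq> 0"
    and Ricci: "\<And>q. q \<in> chart_dom \<kappa> \<Longrightarrow>
      Ric g \<kappa> q + Hessian g \<kappa> \<phi> q = lam *\<^sub>R g \<kappa> q + (m / f q) *\<^sub>R Hessian g \<kappa> f q"
    and scalar: "\<And>q. q \<in> chart_dom \<kappa> \<Longrightarrow>
      2 * lam * \<phi> q - grad_prod g \<kappa> \<phi> \<phi> q + laplacian g \<kappa> \<phi> q + m / f q * grad_prod g \<kappa> \<phi> f q = c"
  shows "\<exists>e. has_germ \<kappa> p (first_integral g lam m f \<phi> \<kappa>) e \<and> (\<forall>i. partial i e = 0)"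
proof -
  obtain k where k: "has_germ \<kappa> p (\<lambda>q. inverse (f q)) k"
    using has_germ_inverse[OF chart point a] f point by blast
  have "a * k = 1"
    using has_germ_mult[OF a k] has_germ_const[of \<kappa> p 1] unfolding germ_const_1
    by (rule germ_cong_unique) (simp add: f)
  moreover have "germ_const m * germ_const (inverse m) = (1 :: (real^'n) germ)"
    using m by (simp add: germ_const_1 flip: germ_const_mult)
  moreover have "Rc i j + hess b i j = germ_const lam * G i j + (germ_const m * k) * hess a i j" for i j
  proof (rule germ_cong_unique)
    show "has_germ \<kappa> p (\<lambda>q. Ric g \<kappa> q $ i $ j + Hessian g \<kappa> \<phi> q $ i $ j) (Rc i j + hess b i j)"
      by (intro has_germ_intros has_germ_Ric has_germ_Hessian b)
    show "has_germ \<kappa> p (\<lambda>q. lam * g \<kappa> q $ i $ j + (m * inverse (f q)) * Hessian g \<kappa> f q $ i $ j)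
        (germ_const lam * G i j + (germ_const m * k) * hess a i j)"
      by (intro has_germ_intros has_germ_metric has_germ_Hessian a k)
    show "Ric g \<kappa> q $ i $ j + Hessian g \<kappa> \<phi> q $ i $ j = lam * g \<kappa> q $ i $ j + (m * inverse (f q)) * Hessian g \<kappa> f q $ i $ j"
      if "q \<in> chart_dom \<kappa>" for q
      using arg_cong[OF Ricci[OF that], of "\<lambda>T. T $ i $ j"] by (simp add: divide_inverse)
  qed
  moreover have "2 * germ_const lam * b - grad_inner b b + tr (hess b) + germ_const m * k * grad_inner b a = germ_const c"
  proof (rule germ_cong_unique)
    \<comment> \<open>The numeral 2 of the ring is 1 + 1 and has to be recognized as a constant
      germ.\<close>
    have "germ_const 2 = (2 :: (real^'n) germ)"
      using germ_const_add[of 1 1] by (simp add: germ_const_1)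
    then show "has_germ \<kappa> p (\<lambda>q. 2 * lam * \<phi> q - grad_prod g \<kappa> \<phi> \<phi> q + laplacian g \<kappa> \<phi> q + m * inverse (f q) * grad_prod g \<kappa> \<phi> f q)
        (2 * germ_const lam * b - grad_inner b b + tr (hess b) + germ_const m * k * grad_inner b a)"
      using has_germ_const[of \<kappa> p 2] by (intro has_germ_intros has_germ_laplacian has_germ_grad_prod a b k) simp
    show "has_germ \<kappa> p (\<lambda>q. c) (germ_const c)"
      by (rule has_germ_const)
  qed (use scalar in \<open>simp add: divide_inverse\<close>)
  ultimately have "partial i (germ_const lam * a\<^sup>2 + a * tr (hess a) + (germ_const m - 1) * grad_inner a a - a * grad_inner b a) = 0" for i
    by (intro soliton_first_integral) (auto simp: germ_deriv_const)
  then show ?thesis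
    using has_germ_first_integral[OF a b] by blast
qed

lemma grad_form_value:
  assumes "has_germ \<kappa> p u a" "has_germ \<kappa> p v b" "has_germ \<kappa> p w c"
  shows "germ_value (grad_form (hess a) b c) = gradient g \<kappa> w p \<bullet> (Hessian g \<kappa> u p *v gradient g \<kappa> v p)"
proof -
  have grad: "(\<Sum>l\<in>UNIV. germ_value (H i l) * germ_value (partial l d)) = gradient g \<kappa> x p $ i"
    if "has_germ \<kappa> p x d" for x d i
    by (simp add: at_point[OF has_germ_metric_inv] at_point[OF has_germ_coord_deriv[OF that]] gradient_def matrix_vector_mult_def differential_def)
  have "germ_value (contr (hess a) b i) = (Hessian g \<kappa> u p *v gradient g \<kappa> v p) $ i" for i
  proof -
    have "germ_value (contr (hess a) b i) = (\<Sum>j\<in>UNIV. Hessian g \<kappa> u p $ i $ j * (\<Sum>l\<in>UNIV. germ_value (H j l) * germ_value (partial l b)))"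
      by (simp add: contr_def germ_value_sum germ_value_simps at_point[OF has_germ_Hessian[OF assms(1)]] sum_distrib_left mult_ac)
    then show ?thesis
      unfolding grad[OF assms(2)] by (simp add: matrix_vector_mult_def)
  qed
  then have "germ_value (grad_form (hess a) b c) = (\<Sum>i\<in>UNIV. (Hessian g \<kappa> u p *v gradient g \<kappa> v p) $ i * (\<Sum>l\<in>UNIV. germ_value (H i l) * germ_value (partial l c)))"
    by (simp add: grad_form_def germ_value_sum germ_value_simps sum_distrib_left mult_ac)
  then show ?thesis
    unfolding grad[OF assms(3)] by (simp add: inner_vec_def mult_ac)
qed

end

section \<open>Independence of the chart\<close>

context riemannian_manifold
begin

text \<open>The transpose of the usual Jacobian of the transition map: rows belong to the coordinate
  fields of \<kappa>, so differentials transform by this matrix itself.\<close>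

definition jacobian :: "('p, 'n) chart \<Rightarrow> ('p, 'n) chart \<Rightarrow> 'p \<Rightarrow> real^'n^'n" where
  "jacobian \<kappa> \<kappa>' p = (\<chi> i j. coord_deriv \<kappa> i (\<lambda>q. coords \<kappa>' q $ j) p)"

lemma chart_pointI: "\<kappa> \<in> \<A> \<Longrightarrow> p \<in> chart_dom \<kappa> \<Longrightarrow> chart_point X \<A> g \<kappa> p"
  by unfold_locales

lemma metric_jacobian:
  assumes "\<kappa> \<in> \<A>" "\<kappa>' \<in> \<A>" "p \<in> chart_dom \<kappa> \<inter> chart_dom \<kappa>'"
  shows "g \<kappa> p = jacobian \<kappa> \<kappa>' p ** g \<kappa>' p ** transpose (jacobian \<kappa> \<kappa>' p)"
proof -
  have "g \<kappa> p $ i $ j = (jacobian \<kappa> \<kappa>' p ** g \<kappa>' p ** transpose (jacobian \<kappa> \<kappa>' p)) $ i $ j" for i j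
    unfolding metric_transform[OF assms]
    by (subst sum.swap) (simp add: jacobian_def matrix_matrix_mult_def transpose_def sum_distrib_left sum_distrib_right mult_ac)
  then show ?thesis
    by (simp add: vec_eq_iff)
qed

text \<open>Multiplying the transformation law of the metric by the inverse metric exhibits a right
  inverse of the Jacobian. For square matrices it is also a left inverse, which is the claim after
  regrouping.\<close>

lemma metric_inv_jacobian:
  assumes "\<kappa> \<in> \<A>" "\<kappa>' \<in> \<A>" "p \<in> chart_dom \<kappa> \<inter> chart_dom \<kappa>'"
  shows "matrix_inv (g \<kappa>' p) = transpose (jacobian \<kappa> \<kappa>' p) ** matrix_inv (g \<kappa> p) ** jacobian \<kappa> \<kappa>' p"
proof (rule matrix_inv_eqI)
  let ?J = "jacobian \<kappa> \<kappa>' p"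
  have "?J ** (g \<kappa>' p ** transpose ?J ** matrix_inv (g \<kappa> p)) = mat 1"
    using metric_inv(1)[OF assms(1), of p] assms(3)
    by (simp add: matrix_mul_assoc flip: metric_jacobian[OF assms])
  then have "(g \<kappa>' p ** transpose ?J ** matrix_inv (g \<kappa> p)) ** ?J = mat 1"
    using matrix_left_right_inverse by blast
  then show "g \<kappa>' p ** (transpose ?J ** matrix_inv (g \<kappa> p) ** ?J) = mat 1"
    by (simp add: matrix_mul_assoc)
qed

lemma differential_jacobian:
  assumes "\<kappa> \<in> \<A>" "\<kappa>' \<in> \<A>" "p \<in> chart_dom \<kappa> \<inter> chart_dom \<kappa>'" "has_germ \<kappa>' p u a"
  shows "differential \<kappa> u p = jacobian \<kappa> \<kappa>' p *v differential \<kappa>' u p"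
  using coord_deriv_change[OF assms] by (simp add: vec_eq_iff differential_def jacobian_def matrix_vector_mult_def)

lemma grad_prod_invariant:
  assumes "\<kappa> \<in> \<A>" "\<kappa>' \<in> \<A>" "p \<in> chart_dom \<kappa> \<inter> chart_dom \<kappa>'" "has_germ \<kappa>' p u a" "has_germ \<kappa>' p v b"
  shows "grad_prod g \<kappa> u v p = grad_prod g \<kappa>' u v p"
proof -
  have p: "p \<in> chart_dom \<kappa>" "p \<in> chart_dom \<kappa>'"
    using assms(3) by auto
  show ?thesis
    unfolding grad_prod_eq[OF assms(1) p(1)] grad_prod_eq[OF assms(2) p(2)]
      differential_jacobian[OF assms(1-3,4)] differential_jacobian[OF assms(1-3,5)] metric_inv_jacobian[OF assms(1-3)]
    by (simp add: dot_matrix_vector_transpose matrix_vector_mul_assoc matrix_mul_assoc del: transpose_matrix_vector)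
qed

lemma has_germ_overlap_cong:
  assumes "\<kappa> \<in> \<A>" "\<kappa>' \<in> \<A>" "p \<in> chart_dom \<kappa> \<inter> chart_dom \<kappa>'"
    "\<And>q. q \<in> chart_dom \<kappa> \<inter> chart_dom \<kappa>' \<Longrightarrow> h q = h' q" "has_germ \<kappa> p h a"
  shows "has_germ \<kappa> p h' a"
  by (rule has_germ_cong[OF assms(1) _ _ assms(3,4,5)]) (simp_all add: openin_Int dom_open assms(1,2) del: split_paired_All)

text \<open>Smoothness on the overlap only, so that it also covers the coordinate functions of
  \<kappa>', which are not smooth functions on the whole manifold.\<close>

definition smooth_overlap :: "('p, 'n) chart \<Rightarrow> ('p, 'n) chart \<Rightarrow> ('p \<Rightarrow> real) \<Rightarrow> bool" where
  "smooth_overlap \<kappa> \<kappa>' u \<longleftrightarrow> (\<forall>q\<in>chart_dom \<kappa> \<inter> chart_dom \<kappa>'. (\<exists>a. has_germ \<kappa> q u a) \<and> (\<exists>a. has_germ \<kappa>' q u a))"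

text \<open>The outer product differentiates the inner one, so the inner one has to be chart
  independent on the whole overlap; then its germ may be exchanged before the outer invariance is
  used.\<close>

lemma grad_prod_twice_invariant:
  assumes "\<kappa> \<in> \<A>" "\<kappa>' \<in> \<A>" "p \<in> chart_dom \<kappa> \<inter> chart_dom \<kappa>'"
    and "smooth_overlap \<kappa> \<kappa>' u" "smooth_overlap \<kappa> \<kappa>' v" "smooth_overlap \<kappa> \<kappa>' w"
  shows "grad_prod g \<kappa> (grad_prod g \<kappa> u v) w p = grad_prod g \<kappa>' (grad_prod g \<kappa>' u v) w p"
proof -
  have p: "p \<in> chart_dom \<kappa>" "p \<in> chart_dom \<kappa>'"
    using assms(3) by auto
  interpret A: chart_point X \<A> g \<kappa> p
    by (rule chart_pointI) fact+
  interpret B: chart_point X \<A> g \<kappa>' p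
    by (rule chart_pointI) fact+
  obtain a b c a' b' c' where germs: "has_germ \<kappa> p u a" "has_germ \<kappa> p v b" "has_germ \<kappa> p w c"
    "has_germ \<kappa>' p u a'" "has_germ \<kappa>' p v b'" "has_germ \<kappa>' p w c'"
    using assms(3-6) unfolding smooth_overlap_def by meson
  have inv: "grad_prod g \<kappa>' u v q = grad_prod g \<kappa> u v q" if "q \<in> chart_dom \<kappa> \<inter> chart_dom \<kappa>'" for q
    using assms(4,5) that grad_prod_invariant[OF assms(1,2) that] unfolding smooth_overlap_def by metis
  have *: "has_germ \<kappa> p (grad_prod g \<kappa>' u v) (A.grad_inner a b)"
    by (rule has_germ_overlap_cong[OF assms(1-3) inv[symmetric] A.has_germ_grad_prod[OF germs(1,2)]])
  have "grad_prod g \<kappa> (grad_prod g \<kappa> u v) w p = germ_value (A.grad_inner (A.grad_inner a b) c)"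
    using A.at_point[OF A.has_germ_grad_prod[OF A.has_germ_grad_prod[OF germs(1,2)] germs(3)]] by simp
  also have "\<dots> = grad_prod g \<kappa> (grad_prod g \<kappa>' u v) w p"
    using A.at_point[OF A.has_germ_grad_prod[OF * germs(3)]] by simp
  also have "\<dots> = grad_prod g \<kappa>' (grad_prod g \<kappa>' u v) w p"
    by (rule grad_prod_invariant[OF assms(1-3) B.has_germ_grad_prod[OF germs(4,5)] germs(6)])
  finally show ?thesis .
qed

text \<open>By polarization the value is a combination of iterated gradient products, whose
  invariance is already known.\<close>

lemma Hessian_invariant:
  assumes "\<kappa> \<in> \<A>" "\<kappa>' \<in> \<A>" "p \<in> chart_dom \<kappa> \<inter> chart_dom \<kappa>'"
    and "smooth_overlap \<kappa> \<kappa>' u" "smooth_overlap \<kappa> \<kappa>' v" "smooth_overlap \<kappa> \<kappa>' w"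
  shows "gradient g \<kappa> w p \<bullet> (Hessian g \<kappa> u p *v gradient g \<kappa> v p)
    = gradient g \<kappa>' w p \<bullet> (Hessian g \<kappa>' u p *v gradient g \<kappa>' v p)"
proof -
  have polar: "2 * (gradient g \<kappa> w p \<bullet> (Hessian g \<kappa> u p *v gradient g \<kappa> v p))
      = grad_prod g \<kappa> (grad_prod g \<kappa> u w) v p + grad_prod g \<kappa> (grad_prod g \<kappa> u v) w p
        - grad_prod g \<kappa> (grad_prod g \<kappa> v w) u p"
    if \<kappa>: "\<kappa> \<in> \<A>" "p \<in> chart_dom \<kappa>" and germs: "has_germ \<kappa> p u a" "has_germ \<kappa> p v b" "has_germ \<kappa> p w c"
    for \<kappa> a b c
  proof -
    interpret chart_point X \<A> g \<kappa> p
      by (rule chart_pointI) fact+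
    have two: "germ_value (2 :: (real^'n) germ) = 2"
      using germ_value_simps(1)[of 1 1] by (simp add: germ_value_simps)
    have "2 * (gradient g \<kappa> w p \<bullet> (Hessian g \<kappa> u p *v gradient g \<kappa> v p)) = germ_value (2 * grad_form (hess a) b c)"
      by (simp add: grad_form_value[OF germs] germ_value_simps two)
    also have "\<dots> = grad_prod g \<kappa> (grad_prod g \<kappa> u w) v p + grad_prod g \<kappa> (grad_prod g \<kappa> u v) w p
        - grad_prod g \<kappa> (grad_prod g \<kappa> v w) u p"
      unfolding hess_polarization using germs by (simp add: germ_value_simps at_point[OF has_germ_grad_prod[OF has_germ_grad_prod]])
    finally show ?thesis .
  qed
  obtain a b c a' b' c' where germs: "has_germ \<kappa> p u a" "has_germ \<kappa> p v b" "has_germ \<kappa> p w c"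
    "has_germ \<kappa>' p u a'" "has_germ \<kappa>' p v b'" "has_germ \<kappa>' p w c'"
    using assms(3-6) unfolding smooth_overlap_def by meson
  show ?thesis
    using polar[OF assms(1) _ germs(1-3)] polar[OF assms(2) _ germs(4-6)] assms
    by (simp add: grad_prod_twice_invariant[OF assms(1-3)])
qed

text \<open>The test functions are the coordinates of \<kappa>'. Their gradients have the inverse of
  g' as Gram matrix, so weighting the Hessian on pairs of them by the entries of g' yields its trace
  in either chart, while each summand is chart independent.\<close>

lemma laplacian_invariant:
  assumes "\<kappa> \<in> \<A>" "\<kappa>' \<in> \<A>" "p \<in> chart_dom \<kappa> \<inter> chart_dom \<kappa>'" and u: "smooth_overlap \<kappa> \<kappa>' u"
  shows "laplacian g \<kappa> u p = laplacian g \<kappa>' u p"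
proof -
  have p: "p \<in> chart_dom \<kappa>" "p \<in> chart_dom \<kappa>'"
    using assms(3) by auto
  define y where "y j q = coords \<kappa>' q $ j" for j q
  have y: "smooth_overlap \<kappa> \<kappa>' (y j)" for j
    unfolding smooth_overlap_def y_def using has_germ_coordinate[OF assms(1,2)] has_germ_coordinate[OF assms(2,2)] by blast
  define A where "A = g \<kappa>' p"
  have sum: "(\<Sum>a\<in>UNIV. \<Sum>b\<in>UNIV. A $ a $ b * (gradient g \<kappa>1 (y b) p \<bullet> (Hessian g \<kappa>1 u p *v gradient g \<kappa>1 (y a) p)))
     = laplacian g \<kappa>1 u p" if \<kappa>1: "\<kappa>1 \<in> \<A>" "p \<in> chart_dom \<kappa>1 \<inter> chart_dom \<kappa>'" for \<kappa>1
  proof -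
    define J where "J = jacobian \<kappa>1 \<kappa>' p"
    define K where "K = matrix_inv (g \<kappa>1 p)"
    have p1: "p \<in> chart_dom \<kappa>1"
      using \<kappa>1 by blast
    have grad: "gradient g \<kappa>1 (y j) p = K *v column j J" for j
      by (simp add: gradient_def K_def J_def y_def[abs_def] jacobian_def column_def differential_def)
    have K: "transpose K = K" "K ** g \<kappa>1 p = mat 1"
      unfolding K_def using metric_inv_sym[OF \<kappa>1(1) p1] metric_inv[OF \<kappa>1(1) p1] by auto
    have "(K *v x) \<bullet> (Hessian g \<kappa>1 u p *v (K *v z)) = x \<bullet> ((K ** Hessian g \<kappa>1 u p ** K) *v z)" for x z
      by (simp add: dot_matrix_vector_transpose K(1) matrix_vector_mul_assoc matrix_mul_assoc del: transpose_matrix_vector)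
    then have "(\<Sum>a\<in>UNIV. \<Sum>b\<in>UNIV. A $ a $ b * (gradient g \<kappa>1 (y b) p \<bullet> (Hessian g \<kappa>1 u p *v gradient g \<kappa>1 (y a) p)))
      = trace (J ** A ** transpose J ** (K ** Hessian g \<kappa>1 u p ** K))"
      unfolding grad by (simp add: trace_congruence)
    also have "J ** A ** transpose J = g \<kappa>1 p"
      unfolding J_def A_def using metric_jacobian[OF \<kappa>1(1) assms(2) \<kappa>1(2)] by simp
    also have "trace (g \<kappa>1 p ** (K ** Hessian g \<kappa>1 u p ** K)) = trace (K ** Hessian g \<kappa>1 u p)"
      by (subst trace_mul_sym) (simp add: K(2) flip: matrix_mul_assoc)
    finally show ?thesis
      by (simp add: laplacian_def K_def)
  qed
  show ?thesis
    using sum[OF assms(1,3)] sum[OF assms(2)] p Hessian_invariant[OF assms(1-3) u y y] by simp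
qed

lemma first_integral_invariant:
  assumes "\<kappa> \<in> \<A>" "\<kappa>' \<in> \<A>" "p \<in> chart_dom \<kappa> \<inter> chart_dom \<kappa>'"
    and "smooth_overlap \<kappa> \<kappa>' f" "smooth_overlap \<kappa> \<kappa>' \<phi>"
  shows "first_integral g lam m f \<phi> \<kappa> p = first_integral g lam m f \<phi> \<kappa>' p"
proof -
  obtain a b where "has_germ \<kappa>' p f a" "has_germ \<kappa>' p \<phi> b"
    using assms(3-5) unfolding smooth_overlap_def by blast
  then show ?thesis
    unfolding first_integral_def
    using laplacian_invariant[OF assms(1-4)] grad_prod_invariant[OF assms(1-3)] by metis
qed

lemma smooth_function_has_germ:
  assumes "smooth_function \<A> u" "\<kappa> \<in> \<A>" "p \<in> chart_dom \<kappa>"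
  shows "\<exists>a. has_germ \<kappa> p u a"
  using assms(1,2) unfolding smooth_function_def
  by (intro has_germ_smooth[OF assms(2) dom_open[OF assms(2)] order_refl assms(3)]) simp

end

section \<open>From local to global constancy\<close>

lemma connected_space_locally_constant:
  assumes "connected_space X" "\<And>p. p \<in> topspace X \<Longrightarrow> \<exists>W. openin X W \<and> p \<in> W \<and> (\<forall>q\<in>W. h q = h p)"
  shows "\<exists>c. \<forall>p\<in>topspace X. h p = c"
proof (cases "topspace X = {}")
  case False
  then obtain x where x: "x \<in> topspace X"
    by blast
  have open_level: "openin X {p \<in> topspace X. P (h p)}" for P
  proof (subst openin_subopen, safe)
    fix p assume p: "p \<in> topspace X" "P (h p)"
    obtain W where W: "openin X W" "p \<in> W" "\<forall>q\<in>W. h q = h p"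
      using assms(2)[OF p(1)] by blast
    have "W \<subseteq> {p \<in> topspace X. P (h p)}"
    proof
      fix q assume "q \<in> W"
      moreover from this have "h q = h p"
        using W(3) by blast
      ultimately show "q \<in> {p \<in> topspace X. P (h p)}"
        using p(2) openin_subset[OF W(1)] by auto
    qed
    then show "\<exists>T. openin X T \<and> p \<in> T \<and> T \<subseteq> {p \<in> topspace X. P (h p)}"
      using W by blast
  qed
  have "{p \<in> topspace X. h p = h x} \<inter> {p \<in> topspace X. h p \<noteq> h x} = {}"
    by blast
  moreover have "topspace X \<subseteq> {p \<in> topspace X. h p = h x} \<union> {p \<in> topspace X. h p \<noteq> h x}"
    by blast
  ultimately have "{p \<in> topspace X. h p \<noteq> h x} = {}"
    using assms(1) x open_level[of "\<lambda>t. t = h x"] open_level[of "\<lambda>t. t \<noteq> h x"]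
    unfolding connected_space_def by blast
  then show ?thesis
    by blast
qed simp

theorem proposition3:
  fixes X :: "'p topology" and \<A> :: "('p, 'n::finite) chart set" and g :: "('p, 'n) metric"
    and f \<phi> :: "'p \<Rightarrow> real" and m c lam :: real
  assumes "riemannian_manifold X \<A> g"
    and "connected_space X"
    and "smooth_function \<A> f" and "smooth_function \<A> \<phi>"
    and "\<forall>p\<in>topspace X. f p > 0"
    and "m \<noteq> 0"
    and "\<forall>\<kappa>\<in>\<A>. \<forall>p\<in>chart_dom \<kappa>.
      Ric g \<kappa> p + Hessian g \<kappa> \<phi> p = lam *\<^sub>R g \<kappa> p + (m / f p) *\<^sub>R Hessian g \<kappa> f p"
    and "\<forall>\<kappa>\<in>\<A>. \<forall>p\<in>chart_dom \<kappa>.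
      2 * lam * \<phi> p - (metric_norm g \<kappa> p (gradient g \<kappa> \<phi> p))\<^sup>2 + laplacian g \<kappa> \<phi> p
        + m / f p * metric_inner g \<kappa> p (gradient g \<kappa> \<phi> p) (gradient g \<kappa> f p) = c"
  shows "\<exists>\<mu>::real. \<forall>\<kappa>\<in>\<A>. \<forall>p\<in>chart_dom \<kappa>.
      lam * (f p)\<^sup>2 + f p * laplacian g \<kappa> f p
        + (m - 1) * (metric_norm g \<kappa> p (gradient g \<kappa> f p))\<^sup>2
        - f p * metric_inner g \<kappa> p (gradient g \<kappa> \<phi> p) (gradient g \<kappa> f p) = \<mu>"
proof -
  interpret riemannian_manifold X \<A> g
    by fact
  let ?F = "first_integral g lam m f \<phi>"
  have smooth: "smooth_overlap \<kappa> \<kappa>' f" "smooth_overlap \<kappa> \<kappa>' \<phi>" if "\<kappa> \<in> \<A>" "\<kappa>' \<in> \<A>" for \<kappa> \<kappa>'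
    using smooth_function_has_germ[OF assms(3)] smooth_function_has_germ[OF assms(4)] that
    unfolding smooth_overlap_def by auto
  have inv: "?F \<kappa> p = ?F \<kappa>' p" if "\<kappa> \<in> \<A>" "\<kappa>' \<in> \<A>" "p \<in> chart_dom \<kappa>" "p \<in> chart_dom \<kappa>'" for \<kappa> \<kappa>' p
    using first_integral_invariant[OF that(1,2) _ smooth[OF that(1,2)]] that by blast
  have germ: "\<exists>e. has_germ \<kappa> p (?F \<kappa>) e \<and> (\<forall>i. partial i e = 0)" if \<kappa>: "\<kappa> \<in> \<A>" "p \<in> chart_dom \<kappa>" for \<kappa> p
  proof -
    interpret chart_point X \<A> g \<kappa> p
      by (rule chart_pointI) fact+
    obtain a b where ab: "has_germ \<kappa> p f a" "has_germ \<kappa> p \<phi> b"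
      using smooth_function_has_germ assms(3,4) \<kappa> by metis
    show ?thesis
    proof (rule first_integral_deriv[OF ab _ assms(6)])
      fix q assume q: "q \<in> chart_dom \<kappa>"
      show "f q \<noteq> 0"
        using assms(5) chart_dom_subset[OF \<kappa>(1)] q by force
      show "Ric g \<kappa> q + Hessian g \<kappa> \<phi> q = lam *\<^sub>R g \<kappa> q + (m / f q) *\<^sub>R Hessian g \<kappa> f q"
        using assms(7) \<kappa> q by blast
      show "2 * lam * \<phi> q - grad_prod g \<kappa> \<phi> \<phi> q + laplacian g \<kappa> \<phi> q + m / f q * grad_prod g \<kappa> \<phi> f q = c"
        using assms(8) \<kappa> q by (simp add: metric_norm_gradient) (simp add: grad_prod_def)
    qed
  qed
  \<comment> \<open>Local constancy in single charts has to be patched to a statement about one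
    function on the manifold. Some chart at \<open>p\<close> is chosen to define it; by
    \<open>inv\<close> the choice is immaterial.\<close>
  define E where "E p = ?F (SOME \<kappa>. \<kappa> \<in> \<A> \<and> p \<in> chart_dom \<kappa>) p" for p
  have E: "E p = ?F \<kappa> p" if "\<kappa> \<in> \<A>" "p \<in> chart_dom \<kappa>" for \<kappa> p
    using someI[of "\<lambda>\<kappa>. \<kappa> \<in> \<A> \<and> p \<in> chart_dom \<kappa>" \<kappa>] that inv unfolding E_def by blast
  have "\<exists>\<mu>. \<forall>p\<in>topspace X. E p = \<mu>"
  proof (rule connected_space_locally_constant[OF assms(2)])
    fix p assume "p \<in> topspace X"
    then obtain \<kappa> where \<kappa>: "\<kappa> \<in> \<A>" "p \<in> chart_dom \<kappa>"
      using cover by blast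
    obtain W where "openin X W" "p \<in> W" "W \<subseteq> chart_dom \<kappa>" "\<forall>q\<in>W. ?F \<kappa> q = ?F \<kappa> p"
      using zero_deriv_locally_constant[OF \<kappa> germ[OF \<kappa>(1)]] by blast
    then show "\<exists>W. openin X W \<and> p \<in> W \<and> (\<forall>q\<in>W. E q = E p)"
      using E \<kappa> by (metis subsetD)
  qed
  then obtain \<mu> where "\<forall>p\<in>topspace X. E p = \<mu>"
    by blast
  then have "?F \<kappa> p = \<mu>" if "\<kappa> \<in> \<A>" "p \<in> chart_dom \<kappa>" for \<kappa> p
    using E that chart_dom_subset by (metis subsetD)
  then show ?thesis
    by (intro exI[of _ \<mu>]) (simp add: metric_norm_gradient first_integral_def grad_prod_def)
qed

end
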